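(* Let $\mathcal{P}:=\{(x,x^2):x\in[0,1]\}\subset\mathbb{R}^2$ be the standard parabola. For every function $\psi:\mathbb{N}\to[0,\infty)$ (not necessarily monotonic) satisfying $\sum_{q=1}^\infty \psi(q)^2<\infty$, the set $\mathscr{S}_2(\psi)\cap\mathcal{P}$ has measure zero with respect to the induced Lebesgue (arc-length) measure on $\mathcal{P}$. That is, $\mathcal{P}$ is of strong Khintchine type for convergence.
   Context: For $\psi:\mathbb{N}\to[0,\infty)$, define $\mathscr{S}_2(\psi):=\{\mathbf{x}=(x_1,x_2)\in\mathbb{R}^2:\ \text{there are infinitely many } q\in\mathbb{N} \text{ with } \max_{1\le i\le 2}\|q x_i\|<\psi(q)\}$, where $\|\cdot\|$ denotes the distance to the nearest integer. A submanifold $\mathcal{M}\subset\mathbb{R}^k$ is of strong Khintchine type for convergence if for every $\psi:\mathbb{N}\to[0,\infty)$ with $\sum_q\psi(q)^k<\infty$, the set $\mathscr{S}_k(\psi)\cap\mathcal{M}$ has measure zero for the induced Lebesgue measure on $\mathcal{M}$. *)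

theory Defs
  imports "HOL-Analysis.Analysis"
begin

text \<open>
  The simultaneously \<open>\<psi>\<close>-approximable points of \<open>\<real>\<^sup>k\<close>. The distance of a real number to the nearest
  integer is its \<^const>\<open>infdist\<close> from \<open>\<int>\<close>; denominators \<open>q\<close> are positive, so \<open>\<psi> 0\<close> is irrelevant.
\<close>

definition approximable :: "(nat \<Rightarrow> real) \<Rightarrow> (real^'k) set" where
  "approximable \<psi> = {x. infinite {q. q \<ge> 1 \<and> (MAX i. infdist (real q * x $ i) \<int>) < \<psi> q}}"

text \<open>
  The measure induced by Lebesgue measure on the image of a \<open>C\<^sup>1\<close> curve \<open>\<gamma>\<close> that is injective on \<open>[a, b]\<close>:
  the push-forward under \<open>\<gamma>\<close> of \<open>\<parallel>\<gamma>'(t)\<parallel> dt\<close>. It is a Borel measure on the whole ambient space,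
  concentrated on the curve.
\<close>

definition arc_length_measure ::
  "(real \<Rightarrow> 'a::euclidean_space) \<Rightarrow> real \<Rightarrow> real \<Rightarrow> 'a measure" where
  "arc_length_measure \<gamma> a b =
     distr (density (restrict_space lborel {a..b})
              (\<lambda>t. ennreal (norm (vector_derivative \<gamma> (at t within {a..b})))))
           borel \<gamma>"

text \<open>
  Here \<open>\<mu>\<close> is meant to be the induced Lebesgue measure on the submanifold \<open>M\<close>. The exponent of
  \<open>\<psi>\<close> is the dimension of the ambient space, and no monotonicity is assumed.
\<close>

definition strong_Khintchine_convergence :: "(real^'k) set \<Rightarrow> (real^'k) measure \<Rightarrow> bool" where
  "strong_Khintchine_convergence M \<mu> \<longleftrightarrow>
     (\<forall>\<psi>. (\<forall>q\<ge>1. 0 \<le> \<psi> q) \<longrightarrow> summable (\<lambda>q. \<psi> (Suc q) ^ CARD('k)) \<longrightarrow>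
          approximable \<psi> \<inter> M \<in> null_sets \<mu>)"

definition parabola_curve :: "real \<Rightarrow> real^2" where
  "parabola_curve x = vector [x, x\<^sup>2]"

definition parabola :: "(real^2) set" where
  "parabola = parabola_curve ` {0..1}"

text \<open>
  Both \<^const>\<open>density\<close> and \<^const>\<open>distr\<close> degenerate on non-measurable input; the following shows that
  the arc-length measure of the parabola is the intended one.
\<close>

lemma parabola_curve_has_vector_derivative:
  "(parabola_curve has_vector_derivative vector [1, 2 * t]) (at t within S)"
proof -
  have eq: "parabola_curve = (\<lambda>x. x *\<^sub>R axis 1 1 + x\<^sup>2 *\<^sub>R axis 2 1)"
    by (auto simp: parabola_curve_def fun_eq_iff vec_eq_iff forall_2 axis_def)
  have v: "(vector [1, 2 * t] :: real^2) = axis 1 1 + (2 * t) *\<^sub>R axis 2 1"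
    by (auto simp: vec_eq_iff forall_2 axis_def)
  show ?thesis
    unfolding eq v by (auto intro!: derivative_eq_intros)
qed

lemma emeasure_arc_length_measure_parabola:
  assumes "A \<in> sets borel"
  shows "emeasure (arc_length_measure parabola_curve 0 1) A =
           (\<integral>\<^sup>+t\<in>{0..1}. ennreal (sqrt (1 + 4 * t\<^sup>2)) * indicator A (vector [t, t\<^sup>2] :: real^2) \<partial>lborel)"
proof -
  let ?L = "restrict_space lborel {0..1::real}"
  let ?f = "\<lambda>t::real. ennreal (sqrt (1 + 4 * t\<^sup>2))"
  have speed: "norm (vector_derivative parabola_curve (at t within {0..1})) = sqrt (1 + 4 * t\<^sup>2)"
    if "t \<in> {0..1}" for t
    using vector_derivative_within_cbox[of 0 1 t, OF _ _ parabola_curve_has_vector_derivative] that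
    by (simp add: norm_vec_def L2_set_def sum_2 power_mult_distrib)
  have cont: "continuous_on UNIV parabola_curve"
    using parabola_curve_has_vector_derivative by (rule continuous_on_vector_derivative)
  then have meas: "parabola_curve \<in> ?L \<rightarrow>\<^sub>M borel"
    by (intro measurable_restrict_space1) (simp add: borel_measurable_continuous_onI)
  have f: "?f \<in> borel_measurable ?L"
    by (intro measurable_restrict_space1) measurable
  have d: "density ?L (\<lambda>t. ennreal (norm (vector_derivative parabola_curve (at t within {0..1})))) =
           density ?L ?f"
    unfolding density_def
    by (intro arg_cong[where f = "measure_of _ _"] ext nn_integral_cong)
       (simp add: speed space_restrict_space)
  have "emeasure (arc_length_measure parabola_curve 0 1) A =
          emeasure (density ?L ?f) (parabola_curve -` A \<inter> space ?L)"
    unfolding arc_length_measure_def d using meas assms by (subst emeasure_distr) auto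
  also have "\<dots> = (\<integral>\<^sup>+t. ?f t * indicator (parabola_curve -` A \<inter> space ?L) t \<partial>?L)"
    by (rule emeasure_density[OF f measurable_sets[OF meas assms]])
  also have "\<dots> = (\<integral>\<^sup>+t\<in>{0..1}. ?f t * indicator (parabola_curve -` A \<inter> space ?L) t \<partial>lborel)"
    by (subst nn_integral_restrict_space) auto
  also have "\<dots> = (\<integral>\<^sup>+t\<in>{0..1}. ?f t * indicator A (vector [t, t\<^sup>2] :: real^2) \<partial>lborel)"
    by (intro nn_integral_cong)
       (auto simp: parabola_curve_def space_restrict_space split: split_indicator)
  finally show ?thesis .
qed

end

theory Submission
  imports
    Defs
    "HOL-Complex_Analysis.Complex_Analysis"
    "HOL-Probability.Probability"
    "HOL-Real_Asymp.Real_Asymp"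
    "HOL-Computational_Algebra.Squarefree"
    "HOL-Library.Discrete_Functions"
begin

text \<open>
  For \<open>x \<in> [0, 1]\<close> with \<open>q x\<close> and \<open>q x\<^sup>2\<close> both within \<open>\<psi> q\<close> of integers, the integer \<open>p\<close> nearest to
  \<open>q x\<close> satisfies \<open>\<parallel>p\<^sup>2 / q\<parallel> < 4 \<psi> q\<close>. By Borel-Cantelli it therefore suffices that the number
  \<open>N(q, \<delta>)\<close> of \<open>p < q\<close> with \<open>\<parallel>p\<^sup>2 / q\<parallel> < \<delta>\<close> is at most \<open>C \<delta> q + E(q)\<close>, where \<open>E(q) / q\<close> is square
  summable: the contribution \<open>\<psi>(q) E(q) / q\<close> of the error is then absorbed by \<open>\<psi>(q)\<^sup>2 + (E(q) / q)\<^sup>2\<close>.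

  A Fejer kernel of length \<open>H \<approx> 1 / \<delta>\<close> bounds \<open>N(q, \<delta>)\<close> by an average of the quadratic Gauss sums
  \<open>G(h; q)\<close> with \<open>h < H\<close>. The square-root bound for each Gauss sum misses square summability only
  by logarithms, so any power saving on average over \<open>q\<close> is enough. The Landsberg-Schaar identity turns
  \<open>G(h; q) / sqrt q\<close> into an exponential sum in \<open>q\<close> with frequencies \<open>n\<^sup>2 / (4 h)\<close>, and the large
  sieve for these rational frequencies gives the saving, provided that few pairs \<open>(h, n)\<close> share a
  frequency. Values \<open>\<delta> < q powr -0.51\<close> need no separate treatment since \<open>N(q, \<delta>)\<close> is monotone in \<open>\<delta>\<close>.
\<close>

subsection \<open>Gauss sum reciprocity\<close>

text \<open>Why the exponents fit. After division by \<open>q\<close> the main term at the longest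
  length \<open>H\<close> contributes order \<open>1 / H^2\<close> to the square, which is summable
  only if \<open>H\<close> exceeds \<open>q powr (1/2)\<close> by a power. But frequencies with
  denominators \<open>4 h\<close> are only guaranteed to be \<open>1 / (4 H^2)\<close> apart, so at
  that length the large sieve loses a factor \<open>H^2 / q\<close>, about
  \<open>q powr 0.02\<close>. The coefficients must pay for it. If all pairs \<open>(h, n)\<close>
  had distinct frequencies, their squared weights would sum to order \<open>1 / H\<close>;
  collisions concentrate weight, for instance at 0, where \<open>4 h\<close> divides the square of
  \<open>n\<close>. Splitting the frequencies at denominator \<open>R\<close> gives
  \<open>R^4 / H + 1 / R\<close> up to logarithms, hence a saving \<open>H powr (-1/5)\<close>. This
  is a power of \<open>q\<close> only if \<open>H\<close> is one, so short lengths need the trivial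
  bound. That bound suffices up to \<open>q powr (1/3)\<close>, where the saving is already
  \<open>q powr (-1/15)\<close>. Since \<open>1.02 - 1/15 = 143/150 < 1\<close>, a margin of
  \<open>7/150\<close> absorbs all logarithms, and an elementary large sieve with a logarithmic loss
  is enough.\<close>

definition chirp :: "real \<Rightarrow> complex \<Rightarrow> complex" where
  "chirp c z = exp (2 * of_real pi * \<i> * of_real c * z\<^sup>2)"

lemma chirp_holomorphic [holomorphic_intros]: "chirp c holomorphic_on A"
  unfolding chirp_def [abs_def] by (intro holomorphic_intros)

lemma continuous_on_chirp [continuous_intros]: "continuous_on A (chirp c)"
  by (intro holomorphic_on_imp_continuous_on holomorphic_intros)

text \<open>Since \<open>(1 + \<i>)^2 = 2 * \<i>\<close>, the oscillating factor becomes a real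
  decaying Gaussian in the direction \<open>1 + \<i>\<close>. For this reason all long sides of the
  contours below run in that direction.\<close>

lemma chirp_diagonal: "chirp c (of_real t * (1 + \<i>)) = of_real (exp (- (4 * pi * c * t\<^sup>2)))"
proof -
  have "2 * of_real pi * \<i> * of_real c * (of_real t * (1 + \<i>))\<^sup>2
      = (of_real (- (4 * pi * c * t\<^sup>2)) :: complex)"
    by (simp add: power2_eq_square algebra_simps)
  then show ?thesis
    unfolding chirp_def by (metis exp_of_real)
qed

lemma norm_chirp:
  "norm (chirp c (of_real x + of_real t * (1 + \<i>))) = exp (- (4 * pi * c * (t\<^sup>2 + x * t)))"
  unfolding chirp_def norm_exp_eq_Re by (simp add: power2_eq_square algebra_simps)

section \<open>Integrals of the chirp along lines in the direction \<open>1 + \<i>\<close>\<close>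

lemma gaussian_integral_symmetric_tendsto:
  fixes c :: real
  assumes "c > 0"
  shows "((\<lambda>R. integral {-R..R} (\<lambda>t. exp (- (4 * pi * c * t\<^sup>2)))) \<longlongrightarrow> 1 / (2 * sqrt c)) at_top"
proof -
  \<comment> \<open>The standard deviation for which the exponent of the normal density is exactly
    \<open>4 * pi * c * t^2\<close>; the total mass 1 then yields the value of the integral.\<close>
  define \<sigma> where "\<sigma> = 1 / sqrt (8 * pi * c)"
  have s: "\<sigma> > 0" and s2: "\<sigma>\<^sup>2 = 1 / (8 * pi * c)"
    using assms by (auto simp: \<sigma>_def power_divide)
  let ?g = "\<lambda>t::real. exp (- (4 * pi * c * t\<^sup>2))"
  have nd: "normal_density 0 \<sigma> t = 2 * sqrt c * ?g t" for t
  proof -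
    have "1 / sqrt (2 * pi * \<sigma>\<^sup>2) = 2 * sqrt c"
      using assms by (simp add: s2 real_sqrt_divide real_sqrt_mult field_simps)
    moreover have "- (t - 0)\<^sup>2 / (2 * \<sigma>\<^sup>2) = - (4 * pi * c * t\<^sup>2)"
      using assms by (simp add: s2 field_simps)
    ultimately show ?thesis
      by (simp add: normal_density_def)
  qed
  have "has_bochner_integral lborel (normal_density 0 \<sigma>) 1"
    using integrable_normal_density[OF s, of 0] integral_normal_density[OF s, of 0]
    by (simp add: has_bochner_integral_iff)
  then have "(normal_density 0 \<sigma> has_integral 1) UNIV"
    using has_integral_integral_lborel[of "normal_density 0 \<sigma>"] by (simp add: has_bochner_integral_iff)
  then have "((\<lambda>t. (1 / (2 * sqrt c)) * normal_density 0 \<sigma> t) has_integral (1 / (2 * sqrt c)) * 1) UNIV"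
    by (rule has_integral_mult_right)
  then have I: "(?g has_integral 1 / (2 * sqrt c)) UNIV"
    using assms by (simp add: nd)
  show ?thesis
  proof (rule tendstoI)
    fix e :: real assume "e > 0"
    with I obtain B where B: "B > 0" "\<And>a b. ball 0 B \<subseteq> cbox a b \<Longrightarrow>
        norm (integral (cbox a b) ?g - 1 / (2 * sqrt c)) < e"
      unfolding has_integral_alt' by (auto simp: )
    show "\<forall>\<^sub>F R in at_top. dist (integral {-R..R} ?g) (1 / (2 * sqrt c)) < e"
      using eventually_ge_at_top[of B]
    proof eventually_elim
      case (elim R)
      have "ball 0 B \<subseteq> cbox (-R) R"
        using elim by (auto simp: dist_norm)
      from B(2)[OF this] show ?case
        by (simp add: dist_norm)
    qed
  qed
qed

lemma contour_integral_chirp_diagonal: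
  assumes "R > 0"
  shows "contour_integral (linepath (- of_real R * (1 + \<i>)) (of_real R * (1 + \<i>))) (chirp c) =
         (1 + \<i>) * of_real (integral {-R..R} (\<lambda>t. exp (- (4 * pi * c * t\<^sup>2))))"
proof -
  let ?g = "\<lambda>t::real. exp (- (4 * pi * c * t\<^sup>2))"
  have "(?g has_integral integral {-R..R} ?g) {-R..R}"
    by (intro integrable_integral integrable_continuous_real continuous_intros)
  then have "((\<lambda>t. of_real (?g t) :: complex) has_integral of_real (integral {-R..R} ?g)) {-R..R}"
    by (rule has_integral_of_real)
  then have "((\<lambda>t. (of_real (?g t) :: complex)) has_integral of_real (integral {-R..R} ?g)) (cbox (-R) R)"
    by simp
  from has_integral_affinity[OF this, of "2 * R" "-R"] assms
  have "((\<lambda>t. of_real (?g (2 * R * t - R))) has_integral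
          (of_real (integral {-R..R} ?g) / (2 * of_real R) :: complex))
          ((\<lambda>x. (1 / (2 * R)) * (x + R)) ` {-R..R})"
    by (simp add: scaleR_conv_of_real field_simps)
  also have "(\<lambda>x. (1 / (2 * R)) * (x + R)) ` {-R..R} = {0..1}"
  proof -
    have "(\<lambda>x. (1 / (2 * R)) * (x + R)) ` {-R..R} = (\<lambda>x. (1 / (2 * R)) * x + 1/2) ` {-R..R}"
      using assms by (intro image_cong) (auto simp: field_simps)
    also have "\<dots> = {0..1}"
      using assms by (subst image_affinity_atLeastAtMost) (auto simp: field_simps)
    finally show ?thesis .
  qed
  finally have "((\<lambda>t. of_real (?g (2 * R * t - R)) * (2 * of_real R * (1 + \<i>))) has_integral
          (of_real (integral {-R..R} ?g) / (2 * of_real R) * (2 * of_real R * (1 + \<i>)))) {0..1}"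
    by (rule has_integral_mult_left)
  moreover have "chirp c (linepath (- of_real R * (1 + \<i>)) (of_real R * (1 + \<i>)) t) = of_real (?g (2 * R * t - R))" for t
  proof -
    have "linepath (- of_real R * (1 + \<i>)) (of_real R * (1 + \<i>)) t = of_real (2 * R * t - R) * (1 + \<i>)"
      by (simp add: linepath_def scaleR_conv_of_real algebra_simps)
    then show ?thesis by (simp only: chirp_diagonal)
  qed
  ultimately have "((chirp c) has_contour_integral of_real (integral {-R..R} ?g) / (2 * of_real R) * (2 * of_real R * (1 + \<i>)))
        (linepath (- of_real R * (1 + \<i>)) (of_real R * (1 + \<i>)))"
    unfolding has_contour_integral_linepath by (simp add: algebra_simps)
  moreover have "of_real (integral {-R..R} ?g) / (2 * of_real R) * (2 * of_real R * (1 + \<i>))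
      = (1 + \<i>) * of_real (integral {-R..R} ?g)"
    using assms by simp
  ultimately show ?thesis
    by (metis contour_integral_unique)
qed

lemma closed_segment_diagonal_shift:
  assumes "z \<in> closed_segment (of_real x + of_real t * (1 + \<i>)) (of_real y + of_real t * (1 + \<i>))"
  obtains u where "z = of_real u + of_real t * (1 + \<i>)" "u \<in> closed_segment x y"
proof -
  from assms obtain s where s: "0 \<le> s" "s \<le> 1"
    "z = (1 - s) *\<^sub>R (of_real x + of_real t * (1 + \<i>)) + s *\<^sub>R (of_real y + of_real t * (1 + \<i>))"
    by (auto simp: closed_segment_def)
  show thesis
  proof (rule that)
    show "z = of_real ((1 - s) *\<^sub>R x + s *\<^sub>R y) + of_real t * (1 + \<i>)"
      using s(3) by (simp add: scaleR_conv_of_real algebra_simps)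
    show "(1 - s) *\<^sub>R x + s *\<^sub>R y \<in> closed_segment x y"
      using s unfolding closed_segment_def by blast
  qed
qed

text \<open>The factor \<open>M\<close> allows for the denominator \<open>exp (2 \<pi> \<i> z) - 1\<close> of the kernel in Mordell's integral.\<close>

lemma contour_integral_chirp_horizontal_tendsto_0:
  fixes f :: "complex \<Rightarrow> complex" and \<sigma> :: real
  assumes c: "c > 0" and \<sigma>: "\<bar>\<sigma>\<bar> = 1" and M: "M \<ge> 0"
    and f: "\<forall>\<^sub>F R in at_top. \<forall>u\<in>closed_segment x y.
              norm (f (of_real u + of_real (\<sigma> * R) * (1 + \<i>))) \<le> M * norm (chirp c (of_real u + of_real (\<sigma> * R) * (1 + \<i>)))"
    and int: "\<forall>\<^sub>F R in at_top. f contour_integrable_on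
       (linepath (of_real x + of_real (\<sigma> * R) * (1 + \<i>)) (of_real y + of_real (\<sigma> * R) * (1 + \<i>)))"
  shows "((\<lambda>R. contour_integral
       (linepath (of_real x + of_real (\<sigma> * R) * (1 + \<i>)) (of_real y + of_real (\<sigma> * R) * (1 + \<i>))) f) \<longlongrightarrow> 0) at_top"
proof (rule Lim_null_comparison)
  \<comment> \<open>\<open>X\<close> dominates \<open>\<bar>u\<bar>\<close> on the whole segment,
    whichever endpoint is larger, so the linear term of the exponent costs at most
    \<open>X * R\<close> against \<open>R^2\<close>.\<close>
  define X where "X = \<bar>x\<bar> + \<bar>y\<bar>"
  show "\<forall>\<^sub>F R in at_top. norm (contour_integral
       (linepath (of_real x + of_real (\<sigma> * R) * (1 + \<i>)) (of_real y + of_real (\<sigma> * R) * (1 + \<i>))) f)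
       \<le> M * exp (- (4 * pi * c * (R\<^sup>2 - X * R))) * \<bar>y - x\<bar>"
    using f int eventually_ge_at_top[of 0]
  proof eventually_elim
    case (elim R)
    have "norm (f z) \<le> M * exp (- (4 * pi * c * (R\<^sup>2 - X * R)))"
      if "z \<in> closed_segment (of_real x + of_real (\<sigma> * R) * (1 + \<i>)) (of_real y + of_real (\<sigma> * R) * (1 + \<i>))" for z
    proof -
      from that obtain u where u: "z = of_real u + of_real (\<sigma> * R) * (1 + \<i>)" "u \<in> closed_segment x y"
        by (rule closed_segment_diagonal_shift)
      have uX: "\<bar>u\<bar> \<le> X"
        using u(2) by (auto simp: X_def closed_segment_eq_real_ivl split: if_splits)
      have "norm (f z) \<le> M * norm (chirp c z)"
        using elim u by blast
      also have "norm (chirp c z) = exp (- (4 * pi * c * ((\<sigma> * R)\<^sup>2 + u * (\<sigma> * R))))"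
        unfolding u(1) by (rule norm_chirp)
      also have "\<dots> \<le> exp (- (4 * pi * c * (R\<^sup>2 - X * R)))"
      proof -
        have "(\<sigma> * R)\<^sup>2 = R\<^sup>2"
          using \<sigma> by (simp add: power_mult_distrib flip: power2_abs[of \<sigma>])
        moreover have "\<bar>u * (\<sigma> * R)\<bar> \<le> X * R"
          using uX \<sigma> elim(3) by (simp add: abs_mult mult_right_mono)
        ultimately have "(\<sigma> * R)\<^sup>2 + u * (\<sigma> * R) \<ge> R\<^sup>2 - X * R"
          by linarith
        then show ?thesis using c by simp
      qed
      finally show ?thesis using M by (simp add: mult_left_mono)
    qed
    from contour_integral_bound_linepath[OF elim(2) _ this]
    show ?case using M by (simp flip: of_real_diff)
  qed
  have "filterlim (\<lambda>R::real. R\<^sup>2 - X * R) at_top at_top"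
  proof -
    have "filterlim (\<lambda>R::real. R * (R + - X)) at_top at_top"
      by real_asymp
    then show ?thesis by (simp add: power2_eq_square algebra_simps)
  qed
  then have "filterlim (\<lambda>R::real. 4 * pi * c * (R\<^sup>2 - X * R)) at_top at_top"
    using c by (intro filterlim_tendsto_pos_mult_at_top[OF tendsto_const]) auto
  then have "((\<lambda>R. exp (- (4 * pi * c * (R\<^sup>2 - X * R)))) \<longlongrightarrow> 0) at_top"
    by (intro filterlim_compose[OF exp_at_bot] filterlim_compose[OF filterlim_uminus_at_bot_at_top])
  then have "((\<lambda>R. M * exp (- (4 * pi * c * (R\<^sup>2 - X * R))) * \<bar>y - x\<bar>) \<longlongrightarrow> M * 0 * \<bar>y - x\<bar>) at_top"
    by (intro tendsto_intros)
  then show "((\<lambda>R. M * exp (- (4 * pi * c * (R\<^sup>2 - X * R))) * \<bar>y - x\<bar>) \<longlongrightarrow> 0) at_top"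
    by simp
qed

text \<open>Both sides equal the integral over the direct segment from \<open>b\<close> to
  \<open>d\<close>, by Cauchy's theorem for triangles. This is the tool for shifting a line of
  integration.\<close>

lemma contour_integral_quadrilateral_holomorphic:
  assumes "f holomorphic_on UNIV"
  shows "contour_integral (linepath b c) f + contour_integral (linepath c d) f
       = contour_integral (linepath b a) f + contour_integral (linepath a d) f"
proof -
  have int: "f contour_integrable_on linepath u v" for u v
    using assms by (intro contour_integrable_continuous_linepath continuous_on_subset[OF holomorphic_on_imp_continuous_on]) auto
  have tri: "contour_integral (linepath u v) f + contour_integral (linepath v w) f
       = contour_integral (linepath u w) f" for u v w
  proof -
    have "(f has_contour_integral 0) (linepath u v +++ linepath v w +++ linepath w u)"
      by (rule Cauchy_theorem_triangle) (use assms in \<open>auto intro: holomorphic_on_subset\<close>)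
    then have "contour_integral (linepath u v) f + contour_integral (linepath v w) f
        + contour_integral (linepath w u) f = 0"
      by (rule has_chain_integral_chain_integral3)
    moreover have "contour_integral (linepath w u) f = - contour_integral (linepath u w) f"
      using assms by (intro contour_integral_reverse_linepath holomorphic_on_imp_continuous_on) (auto intro: holomorphic_on_subset)
    ultimately show ?thesis by simp
  qed
  show ?thesis using tri by metis
qed

text \<open>The limit is independent of the offset \<open>s\<close>: the line is shifted to the one
  through the origin, and the two horizontal connections vanish in the limit.\<close>

lemma contour_integral_chirp_tendsto:
  assumes c: "c > 0"
  shows "((\<lambda>R. contour_integral (linepath (of_real s + of_real (-R) * (1 + \<i>)) (of_real s + of_real R * (1 + \<i>))) (chirp c))
           \<longlongrightarrow> (1 + \<i>) / (2 * of_real (sqrt c))) at_top"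
proof -
  let ?p = "\<lambda>x t. of_real x + of_real t * (1 + \<i>) :: complex"
  let ?I = "\<lambda>u v. contour_integral (linepath u v) (chirp c)"
  have int: "chirp c contour_integrable_on (linepath u v)" for u v
    by (intro contour_integrable_continuous_linepath continuous_intros)
  have a: "((\<lambda>R. ?I (?p x (1 * R)) (?p y (1 * R))) \<longlongrightarrow> 0) at_top" for x y
    by (rule contour_integral_chirp_horizontal_tendsto_0[OF c, where M = 1]) (auto simp: int)
  have b: "((\<lambda>R. ?I (?p x (-1 * R)) (?p y (-1 * R))) \<longlongrightarrow> 0) at_top" for x y
    by (rule contour_integral_chirp_horizontal_tendsto_0[OF c, where M = 1]) (auto simp: int)
  have m: "((\<lambda>R. ?I (?p 0 (-R)) (?p 0 R)) \<longlongrightarrow> (1 + \<i>) * of_real (1 / (2 * sqrt c))) at_top"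
  proof (rule Lim_transform_eventually)
    show "((\<lambda>R. (1 + \<i>) * of_real (integral {-R..R} (\<lambda>t. exp (- (4 * pi * c * t\<^sup>2)))))
            \<longlongrightarrow> (1 + \<i>) * of_real (1 / (2 * sqrt c))) at_top"
      by (intro tendsto_intros gaussian_integral_symmetric_tendsto c)
    show "\<forall>\<^sub>F R in at_top. (1 + \<i>) * of_real (integral {-R..R} (\<lambda>t. exp (- (4 * pi * c * t\<^sup>2))))
             = ?I (?p 0 (-R)) (?p 0 R)"
      using eventually_gt_at_top[of 0]
      by eventually_elim (use contour_integral_chirp_diagonal[of _ c] in simp)
  qed
  have "((\<lambda>R. ?I (?p s (-1 * R)) (?p 0 (-1 * R)) + ?I (?p 0 (-R)) (?p 0 R) + ?I (?p 0 (1 * R)) (?p s (1 * R)))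
     \<longlongrightarrow> 0 + (1 + \<i>) * of_real (1 / (2 * sqrt c)) + 0) at_top"
    by (intro tendsto_add a b m)
  moreover have "?I (?p s (-1 * R)) (?p 0 (-1 * R)) + ?I (?p 0 (-R)) (?p 0 R) + ?I (?p 0 (1 * R)) (?p s (1 * R))
     = ?I (?p s (-R)) (?p s R)" for R
    using contour_integral_quadrilateral_holomorphic[of "chirp c" "?p s (-R)" "?p 0 (-R)" "?p 0 R" "?p 0 R"]
      contour_integral_quadrilateral_holomorphic[of "chirp c" "?p s (-R)" "?p 0 R" "?p s R" "?p s R"]
    by (simp add: holomorphic_intros)
  ultimately show ?thesis by (simp add: field_simps)
qed

section \<open>The parallelogram contour and its winding number\<close>

lemma slanted_segment:
  fixes a s t :: real
  assumes "z \<in> closed_segment (of_real a + of_real s * (1 + \<i>)) (of_real a + of_real t * (1 + \<i>))"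
  shows "Re z - Im z = a"
proof -
  from assms obtain u where "z = (1 - u) *\<^sub>R (of_real a + of_real s * (1 + \<i>)) + u *\<^sub>R (of_real a + of_real t * (1 + \<i>))"
    by (auto simp: closed_segment_def)
  then have "Re z = (1 - u) * (a + s) + u * (a + t)" "Im z = (1 - u) * s + u * t"
    by simp_all
  then show ?thesis by (simp add: algebra_simps)
qed

lemma horizontal_segment:
  fixes x y t :: real
  assumes "z \<in> closed_segment (of_real x + of_real t * (1 + \<i>)) (of_real y + of_real t * (1 + \<i>))"
  shows "Im z = t"
  using assms by (elim closed_segment_diagonal_shift) simp

text \<open>Seen from \<open>p\<close>, each of the four sides has winding number with positive real
  part below 1/2. The total is therefore strictly between 0 and 2, and a closed path leaves only the
  integer 1.\<close>

lemma winding_number_parallelogram: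
  fixes a b p R :: real
  assumes "a < p" "p < b" "R > 0"
  defines "P \<equiv> \<lambda>x t. of_real x + of_real t * (1 + \<i>) :: complex"
  shows "winding_number (linepath (P a (-R)) (P b (-R)) +++ linepath (P b (-R)) (P b R) +++
           linepath (P b R) (P a R) +++ linepath (P a R) (P a (-R))) (of_real p) = 1"
proof -
  have [simp]: "of_real p \<notin> closed_segment (P a (-R)) (P b (-R))" "of_real p \<notin> closed_segment (P b R) (P a R)"
    using assms(3) horizontal_segment[of "of_real p" a "-R" b] horizontal_segment[of "of_real p" b R a]
    unfolding P_def by auto
  have [simp]: "of_real p \<notin> closed_segment (P b (-R)) (P b R)" "of_real p \<notin> closed_segment (P a R) (P a (-R))"
    using assms(1,2) slanted_segment[of "of_real p" b "-R" R] slanted_segment[of "of_real p" a R "-R"]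
    unfolding P_def by auto
  have pos: "0 < Re (winding_number (linepath (P a (-R)) (P b (-R))) p)"
    "0 < Re (winding_number (linepath (P b (-R)) (P b R)) p)"
    "0 < Re (winding_number (linepath (P b R) (P a R)) p)"
    "0 < Re (winding_number (linepath (P a R) (P a (-R))) p)"
    by (rule winding_number_linepath_pos_lt, use assms in \<open>simp add: P_def algebra_simps\<close>)+
  have half: "\<bar>Re (winding_number (linepath (P a (-R)) (P b (-R))) p)\<bar> < 1/2"
    "\<bar>Re (winding_number (linepath (P b (-R)) (P b R)) p)\<bar> < 1/2"
    "\<bar>Re (winding_number (linepath (P b R) (P a R)) p)\<bar> < 1/2"
    "\<bar>Re (winding_number (linepath (P a R) (P a (-R))) p)\<bar> < 1/2"
    by (rule winding_number_lt_half_linepath, simp)+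
  show ?thesis
  proof (rule winding_number_eq_1)
    show "0 < Re (winding_number (linepath (P a (-R)) (P b (-R)) +++ linepath (P b (-R)) (P b R) +++
           linepath (P b R) (P a R) +++ linepath (P a R) (P a (-R))) (of_real p))"
      using pos by (simp add: winding_number_join path_image_join)
    show "Re (winding_number (linepath (P a (-R)) (P b (-R)) +++ linepath (P b (-R)) (P b R) +++
           linepath (P b R) (P a R) +++ linepath (P a R) (P a (-R))) (of_real p)) < 2"
      using half by (simp add: winding_number_join path_image_join)
  qed (simp_all add: path_image_join)
qed

section \<open>Mordell's integral and the reciprocity law\<close>

definition mordell_kernel :: "real \<Rightarrow> complex \<Rightarrow> complex" where
  "mordell_kernel c z = chirp c z / (exp (2 * of_real pi * \<i> * z) - 1)"

lemma exp_2pi_i_eq_1_iff: "exp (2 * of_real pi * \<i> * z) = 1 \<longleftrightarrow> z \<in> \<int>"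
proof
  assume "exp (2 * of_real pi * \<i> * z) = 1"
  then obtain n :: int where "Im z = 0" "2 * pi * Re z = of_int (2 * n) * pi"
    by (auto simp: exp_eq_1)
  then have "z = of_int n" by (auto simp: complex_eq_iff)
  then show "z \<in> \<int>" by simp
qed (auto simp: exp_eq_1 elim!: Ints_cases)

lemma mordell_kernel_holomorphic: "A \<inter> \<int> = {} \<Longrightarrow> mordell_kernel c holomorphic_on A"
  unfolding mordell_kernel_def [abs_def] by (intro holomorphic_intros) (auto simp: exp_2pi_i_eq_1_iff)

text \<open>The denominator has a simple zero with derivative \<open>2 * pi * \<i>\<close> at every
  integer, so \<open>2 * pi * \<i>\<close> times a sum of residues is a sum of chirp values, that
  is, a Gauss sum.\<close>

lemma residue_mordell_kernel:
  assumes "p \<in> \<int>"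
  shows "residue (mordell_kernel c) p = chirp c p / (2 * of_real pi * \<i>)"
  unfolding mordell_kernel_def [abs_def]
proof (rule residue_simple_pole_deriv[of _ UNIV])
  have "((\<lambda>z. exp (2 * of_real pi * \<i> * z) - 1) has_field_derivative
      exp (2 * of_real pi * \<i> * p) * (2 * of_real pi * \<i>)) (at p)"
    by (auto intro!: derivative_eq_intros)
  moreover have e: "exp (2 * of_real pi * \<i> * p) = 1"
    using assms by (simp add: exp_2pi_i_eq_1_iff)
  ultimately show "((\<lambda>z. exp (2 * of_real pi * \<i> * z) - 1) has_field_derivative 2 * of_real pi * \<i>) (at p)"
    by simp
  show "exp (2 * of_real pi * \<i> * p) - 1 = 0" using e by simp
qed (auto intro!: holomorphic_intros simp: chirp_def)

lemma mordell_kernel_contour_integrable: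
  assumes "closed_segment u v \<inter> \<int> = {}"
  shows "mordell_kernel c contour_integrable_on linepath u v"
  by (intro contour_integrable_continuous_linepath holomorphic_on_imp_continuous_on
      mordell_kernel_holomorphic assms)

lemma horizontal_segment_no_Ints:
  assumes "t \<noteq> 0"
  shows "closed_segment (of_real x + of_real t * (1 + \<i>)) (of_real y + of_real t * (1 + \<i>)) \<inter> \<int> = {}"
  using assms by (auto dest!: horizontal_segment elim!: Ints_cases)

lemma slanted_segment_no_Ints:
  assumes "a \<notin> \<int>"
  shows "closed_segment (of_real a + of_real s * (1 + \<i>)) (of_real a + of_real t * (1 + \<i>)) \<inter> \<int> = {}"
  using assms by (auto dest!: slanted_segment elim!: Ints_cases)

lemma minus_half_plus_nat_not_Int: "real q - 1/2 \<notin> \<int>"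
proof
  assume "real q - 1/2 \<in> \<int>"
  then obtain n :: int where "real q - 1/2 = of_int n" by (auto elim: Ints_cases)
  then have "2 * int q - 1 = 2 * n" by linarith
  then show False by presburger
qed

text \<open>The slanted sides cross the real axis at the half-integers \<open>- 1 / 2\<close> and
  \<open>q - 1 / 2\<close>, so the poles inside are exactly \<open>0, ..., q - 1\<close> and none
  lies on the contour.\<close>

lemma contour_integral_mordell_kernel:
  fixes R c :: real and q :: nat
  assumes "R > 0"
  defines "P \<equiv> \<lambda>x t. of_real x + of_real t * (1 + \<i>) :: complex"
  defines "I \<equiv> \<lambda>u v. contour_integral (linepath u v) (mordell_kernel c)"
  defines "a \<equiv> - 1 / 2" and "b \<equiv> real q - 1 / 2"
  shows "I (P a (-R)) (P b (-R)) + I (P b (-R)) (P b R) + I (P b R) (P a R) + I (P a R) (P a (-R))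
           = (\<Sum>p<q. chirp c (of_nat p))"
proof (cases "q = 0")
  \<comment> \<open>The parallelogram degenerates: its slanted sides coincide and cancel, and the
    horizontal sides are single points.\<close>
  case True
  have a: "a \<notin> \<int>" using minus_half_plus_nat_not_Int[of 0] by (simp add: a_def)
  have rev: "I v u = - I u v" if "closed_segment v u \<inter> \<int> = {}" for u v
    unfolding I_def
    by (intro contour_integral_reverse_linepath holomorphic_on_imp_continuous_on
        mordell_kernel_holomorphic that)
  have "I (P a R) (P a (-R)) = - I (P a (-R)) (P a R)"
    by (rule rev) (use slanted_segment_no_Ints[OF a, of R "-R"] in \<open>simp add: P_def\<close>)
  moreover have "b = a" using True by (simp add: a_def b_def)
  ultimately show ?thesis using True by (simp add: I_def)
next
  case False
  \<comment> \<open>An open slanted strip, slightly wider than the contour, that contains no integer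
    besides the enclosed poles; its convexity makes the winding numbers vanish outside.\<close>
  define S where "S = {z :: complex. -1 < Re z - Im z} \<inter> {z. Re z - Im z < real q}"
  define pts where "pts = (of_nat :: nat \<Rightarrow> complex) ` {..<q}"
  let ?g = "linepath (P a (-R)) (P b (-R)) +++ linepath (P b (-R)) (P b R) +++
           linepath (P b R) (P a R) +++ linepath (P a R) (P a (-R))"
  have S_halfspaces: "S = {z. inner (1 - \<i>) z > -1} \<inter> {z. inner (1 - \<i>) z < real q}"
    by (auto simp: S_def inner_complex_def)
  have S: "open S" "connected S" "convex S"
    unfolding S_halfspaces
    by (auto intro!: open_Int open_halfspace_gt open_halfspace_lt convex_connected convex_Int
         convex_halfspace_gt convex_halfspace_lt)
  have a: "a \<notin> \<int>" and b: "b \<notin> \<int>"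
    using minus_half_plus_nat_not_Int[of 0] minus_half_plus_nat_not_Int[of q] by (auto simp: a_def b_def)
  have seg: "closed_segment (P a (-R)) (P b (-R)) \<inter> \<int> = {}" "closed_segment (P b (-R)) (P b R) \<inter> \<int> = {}"
     "closed_segment (P b R) (P a R) \<inter> \<int> = {}" "closed_segment (P a R) (P a (-R)) \<inter> \<int> = {}"
    unfolding P_def using assms(1) a b
    by (intro horizontal_segment_no_Ints slanted_segment_no_Ints; simp)+
  have int: "mordell_kernel c contour_integrable_on linepath (P a (-R)) (P b (-R))"
     "mordell_kernel c contour_integrable_on linepath (P b (-R)) (P b R)"
     "mordell_kernel c contour_integrable_on linepath (P b R) (P a R)"
     "mordell_kernel c contour_integrable_on linepath (P a R) (P a (-R))"
    by (rule mordell_kernel_contour_integrable, rule seg)+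
  have vertices: "P a t \<in> S" "P b t \<in> S" for t
    using False by (auto simp: S_def P_def a_def b_def)
  then have im: "path_image ?g \<subseteq> S"
    using closed_segment_subset[OF _ _ S(3)] by (simp add: path_image_join)
  have "contour_integral ?g (mordell_kernel c)
      = 2 * pi * \<i> * (\<Sum>p\<in>pts. winding_number ?g p * residue (mordell_kernel c) p)"
  proof (rule Residue_theorem[of S])
    have "(S - pts) \<inter> \<int> = {}"
    proof -
      have "of_int n \<in> pts" if "of_int n \<in> S" for n
      proof -
        have "real_of_int n > -1" "real_of_int n < real q" using that by (auto simp: S_def)
        then have "n \<ge> 0" "n < int q" by linarith+
        then have "of_int n = (of_nat (nat n) :: complex)" "nat n < q" by auto
        then show ?thesis unfolding pts_def by blast
      qed
      then show ?thesis by (auto elim!: Ints_cases)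
    qed
    then show "mordell_kernel c holomorphic_on S - pts"
      by (rule mordell_kernel_holomorphic)
    have "path_image ?g \<inter> \<int> = {}"
      using seg by (auto simp: path_image_join)
    then show "path_image ?g \<subseteq> S - pts"
      using im by (auto simp: pts_def)
    show "\<forall>z. z \<notin> S \<longrightarrow> winding_number ?g z = 0"
      using im S(3) by (intro allI impI winding_number_zero_outside[of _ S]) auto
  qed (use S in \<open>auto simp: pts_def\<close>)
  also have "(\<Sum>p\<in>pts. winding_number ?g p * residue (mordell_kernel c) p)
     = (\<Sum>p\<in>pts. chirp c p / (2 * of_real pi * \<i>))"
  proof (rule sum.cong)
    fix p assume "p \<in> pts"
    then obtain n where n: "p = of_nat n" "n < q" by (auto simp: pts_def)
    have "winding_number ?g (of_real (real n)) = 1"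
      unfolding P_def by (rule winding_number_parallelogram) (use n assms(1) in \<open>auto simp: a_def b_def\<close>)
    then show "winding_number ?g p * residue (mordell_kernel c) p = chirp c p / (2 * of_real pi * \<i>)"
      using n by (simp add: residue_mordell_kernel)
  qed simp
  also have "2 * pi * \<i> * \<dots> = (\<Sum>p\<in>pts. chirp c p)"
    by (simp add: sum_distrib_left)
  also have "\<dots> = (\<Sum>p<q. chirp c (of_nat p))"
    unfolding pts_def by (subst sum.reindex) (auto simp: inj_on_def)
  finally show ?thesis
    unfolding I_def using int by (simp add: add.assoc contour_integrable_joinI)
qed

lemma contour_integral_linepath_shift:
  fixes f :: "complex \<Rightarrow> complex"
  shows "contour_integral (linepath (u + w) (v + w)) f = contour_integral (linepath u v) (\<lambda>z. f (z + w))"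
proof -
  have "linepath (u + w) (v + w) x = linepath u v x + w" for x
    by (simp add: linepath_def algebra_simps)
  then have "(f has_contour_integral I) (linepath (u + w) (v + w)) \<longleftrightarrow>
      ((\<lambda>z. f (z + w)) has_contour_integral I) (linepath u v)" for I
    by (simp add: has_contour_integral_linepath)
  then show ?thesis
    unfolding contour_integral_def contour_integrable_on_def by simp
qed

text \<open>For \<open>c = h / q\<close>, translation by \<open>q\<close> keeps the denominator and
  multiplies the chirp by the \<open>2 * h\<close>-th power of
  \<open>exp (2 * pi * \<i> * z)\<close>. The difference is thus a finite geometric sum without
  poles, and its \<open>2 * h\<close> terms become the dual Gauss sum.\<close>

lemma mordell_kernel_shift:
  fixes h q :: nat
  assumes "q > 0" "c = real h / real q" "z \<notin> \<int>"
  shows "mordell_kernel c (z + of_nat q) - mordell_kernel c z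
       = (\<Sum>n<2*h. chirp c z * exp (2 * of_real pi * \<i> * of_nat n * z))"
proof -
  let ?e = "exp (2 * of_real pi * \<i> * z)"
  have e1: "?e \<noteq> 1" using assms(3) by (simp add: exp_2pi_i_eq_1_iff)
  have per: "exp (2 * of_real pi * \<i> * (z + of_nat q)) = ?e"
  proof -
    have "exp (2 * of_real pi * \<i> * of_nat q) = 1" by (simp only: exp_2pi_i_eq_1_iff) simp
    then show ?thesis by (simp add: ring_distribs exp_add)
  qed
  have "chirp c (z + of_nat q) = chirp c z * ?e ^ (2 * h)"
  proof -
    have "2 * of_real pi * \<i> * of_real c * (z + of_nat q)\<^sup>2
      = 2 * of_real pi * \<i> * of_real c * z\<^sup>2 + of_nat (2 * h) * (2 * of_real pi * \<i> * z)
        + 2 * of_real pi * \<i> * of_nat (h * q)"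
    proof -
      have h: "(of_nat h :: complex) = of_real c * of_nat q"
        using assms(1,2) by simp
      show ?thesis
        by (simp add: h power2_eq_square algebra_simps)
    qed
    moreover have "exp (2 * of_real pi * \<i> * of_nat (h * q)) = 1" by (simp only: exp_2pi_i_eq_1_iff) simp
    ultimately show ?thesis
      unfolding chirp_def by (simp only: exp_add exp_of_nat_mult mult_1_right)
  qed
  then have "mordell_kernel c (z + of_nat q) - mordell_kernel c z = chirp c z * ((?e ^ (2 * h) - 1) / (?e - 1))"
    unfolding mordell_kernel_def per by (simp add: diff_divide_distrib right_diff_distrib)
  also have "(?e ^ (2 * h) - 1) / (?e - 1) = (\<Sum>n<2*h. ?e ^ n)"
    using e1 by (simp add: geometric_sum)
  also have "chirp c z * (\<Sum>n<2*h. ?e ^ n) = (\<Sum>n<2*h. chirp c z * exp (2 * of_real pi * \<i> * of_nat n * z))"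
    unfolding sum_distrib_left
    by (intro sum.cong refl) (simp add: mult_ac flip: exp_of_nat_mult)
  finally show ?thesis .
qed

text \<open>For \<open>c = h / q\<close> the phase split off is \<open>n^2 * q / (4 * h)\<close>,
  the one of the dual sum; what remains is a chirp on a translated line.\<close>

lemma chirp_complete_square:
  assumes "c > 0"
  shows "chirp c z * exp (2 * of_real pi * \<i> * of_nat n * z)
       = cis (- (2 * pi * ((real n)\<^sup>2 / (4 * c)))) * chirp c (z + of_real (real n / (2 * c)))"
proof -
  have "2 * of_real pi * \<i> * of_real c * z\<^sup>2 + 2 * of_real pi * \<i> * of_nat n * z
     = \<i> * of_real (- (2 * pi * ((real n)\<^sup>2 / (4 * c)))) + 2 * of_real pi * \<i> * of_real c * (z + of_real (real n / (2 * c)))\<^sup>2"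
    using assms by (simp add: power2_eq_square field_simps)
  then show ?thesis
    unfolding chirp_def cis_conv_exp by (simp only: exp_add [symmetric])
qed

text \<open>At height \<open>R \<ge> 1\<close> the exponential in the denominator has modulus at
  most 1/2 (upper side) or at least 2 (lower side), so it stays at distance at least 1/2 from
  1.\<close>

lemma mordell_kernel_horizontal_bound:
  assumes "\<bar>\<sigma>\<bar> = 1" "R \<ge> 1"
  shows "norm (mordell_kernel c (of_real u + of_real (\<sigma> * R) * (1 + \<i>)))
       \<le> 2 * norm (chirp c (of_real u + of_real (\<sigma> * R) * (1 + \<i>)))"
proof -
  let ?z = "of_real u + of_real (\<sigma> * R) * (1 + \<i>) :: complex"
  let ?e = "exp (2 * of_real pi * \<i> * ?z)"
  have n: "norm ?e = exp (- (2 * pi * (\<sigma> * R)))"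
    unfolding norm_exp_eq_Re by simp
  have "exp (2 * pi * R) \<ge> 1 + 2 * pi * R" by (rule exp_ge_add_one_self)
  moreover have "pi * R \<ge> 1" using pi_ge_two assms(2) by (metis mult_mono' mult_1 one_le_numeral order_trans zero_le_one)
  ultimately have big: "exp (2 * pi * R) \<ge> 2" by linarith
  have "norm (?e - 1) \<ge> 1/2"
  proof (cases "\<sigma> = 1")
    case True
    have "norm ?e \<le> 1/2" using big by (simp add: n True exp_minus field_simps)
    then show ?thesis using norm_triangle_ineq2[of 1 ?e] by (simp add: norm_minus_commute)
  next
    case False
    then have "\<sigma> = -1" using assms by auto
    then have "norm ?e \<ge> 2" using big by (simp add: n)
    then show ?thesis using norm_triangle_ineq2[of ?e 1] by simp
  qed
  then have "norm (chirp c ?z) / norm (?e - 1) \<le> norm (chirp c ?z) / (1/2)"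
    by (intro divide_left_mono) (auto intro: mult_pos_pos order.strict_trans2)
  then show ?thesis
    by (simp add: mordell_kernel_def norm_divide)
qed

text \<open>The residue sum is the Gauss sum modulo \<open>q\<close>. In the limit the horizontal
  sides vanish and the two slanted sides combine, by the shift identity, into \<open>2 * h\<close>
  chirp integrals along parallel lines. These all have the same limit, so only the phases from
  completing the square remain.\<close>

theorem Landsberg_Schaar:
  fixes h q :: nat
  assumes "h > 0" "q > 0"
  shows "(\<Sum>p<q. cis (2 * pi * (real h * (real p)\<^sup>2 / real q)))
       = (1 + \<i>) / 2 * of_real (sqrt (real q / real h)) *
           (\<Sum>n<2*h. cis (- (2 * pi * ((real n)\<^sup>2 * real q / (4 * real h)))))"
proof -
  define c where "c = real h / real q"
  have c: "c > 0" using assms by (simp add: c_def)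
  define P where "P = (\<lambda>x t. of_real x + of_real t * (1 + \<i>) :: complex)"
  define I where "I = (\<lambda>u v. contour_integral (linepath u v) (mordell_kernel c))"
  define a where "a = (- 1 / 2 :: real)"
  define b where "b = real q - 1 / 2"
  define G where "G = (\<Sum>p<q. chirp c (of_nat p))"
  define J where "J = (\<lambda>n R. contour_integral (linepath (P (a + real n / (2 * c)) (-R)) (P (a + real n / (2 * c)) R)) (chirp c))"
  have a: "a \<notin> \<int>" and b: "b \<notin> \<int>"
    using minus_half_plus_nat_not_Int[of 0] minus_half_plus_nat_not_Int[of q] by (auto simp: a_def b_def)
  have vertical: "I (P b (-R)) (P b R) + I (P a R) (P a (-R))
      = (\<Sum>n<2*h. cis (- (2 * pi * ((real n)\<^sup>2 / (4 * c)))) * J n R)" for R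
  proof -
    have Pb: "P b t = P a t + of_nat q" for t
      by (simp add: P_def a_def b_def)
    have sa: "closed_segment (P a (-R)) (P a R) \<inter> \<int> = {}" and sb: "closed_segment (P b (-R)) (P b R) \<inter> \<int> = {}"
      unfolding P_def by (intro slanted_segment_no_Ints a b)+
    have shift: "I (P b (-R)) (P b R) = contour_integral (linepath (P a (-R)) (P a R)) (\<lambda>z. mordell_kernel c (z + of_nat q))"
      unfolding I_def Pb by (rule contour_integral_linepath_shift)
    have rev: "I (P a R) (P a (-R)) = - I (P a (-R)) (P a R)"
      unfolding I_def using sa
      by (intro contour_integral_reverse_linepath holomorphic_on_imp_continuous_on
          mordell_kernel_holomorphic) (simp add: closed_segment_commute)
    have int1: "mordell_kernel c contour_integrable_on linepath (P a (-R)) (P a R)"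
      by (rule mordell_kernel_contour_integrable[OF sa])
    have int2: "(\<lambda>z. mordell_kernel c (z + of_nat q)) contour_integrable_on linepath (P a (-R)) (P a R)"
    proof (intro contour_integrable_continuous_linepath holomorphic_on_imp_continuous_on)
      have "mordell_kernel c \<circ> (\<lambda>z. z + of_nat q) holomorphic_on closed_segment (P a (-R)) (P a R)"
      proof (intro holomorphic_on_compose holomorphic_intros mordell_kernel_holomorphic)
        show "(\<lambda>z. z + of_nat q) ` closed_segment (P a (-R)) (P a R) \<inter> \<int> = {}"
        proof -
          have "z \<in> \<int>" if "z + of_nat q \<in> \<int>" for z :: complex
            using Ints_diff[OF that, of "of_nat q"] by simp
          then show ?thesis using sa by blast
        qed
      qed
      then show "(\<lambda>z. mordell_kernel c (z + of_nat q)) holomorphic_on closed_segment (P a (-R)) (P a R)"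
        by (simp add: comp_def)
    qed
    have int3: "(\<lambda>z. chirp c (z + w)) contour_integrable_on linepath u v" for u v w
      by (intro contour_integrable_continuous_linepath holomorphic_on_imp_continuous_on)
         (auto simp: chirp_def intro!: holomorphic_intros)
    have Jn: "contour_integral (linepath (P a (-R)) (P a R)) (\<lambda>z. chirp c (z + of_real (real n / (2 * c)))) = J n R" for n
      unfolding J_def contour_integral_linepath_shift[symmetric]
      by (simp add: P_def algebra_simps)
    have "I (P b (-R)) (P b R) + I (P a R) (P a (-R))
       = contour_integral (linepath (P a (-R)) (P a R)) (\<lambda>z. mordell_kernel c (z + of_nat q) - mordell_kernel c z)"
      unfolding shift rev using contour_integral_diff[OF int2 int1] by (simp add: I_def)
    also have "\<dots> = contour_integral (linepath (P a (-R)) (P a R))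
        (\<lambda>z. \<Sum>n<2*h. cis (- (2 * pi * ((real n)\<^sup>2 / (4 * c)))) * chirp c (z + of_real (real n / (2 * c))))"
    proof (rule contour_integral_cong)
      fix z assume "z \<in> path_image (linepath (P a (-R)) (P a R))"
      then have "z \<notin> \<int>" using sa by auto
      then show "mordell_kernel c (z + of_nat q) - mordell_kernel c z = (\<Sum>n<2*h. cis (- (2 * pi * ((real n)\<^sup>2 / (4 * c)))) * chirp c (z + of_real (real n / (2 * c))))"
        using mordell_kernel_shift[OF assms(2) c_def] chirp_complete_square[OF c] by simp
    qed simp
    also have "\<dots> = (\<Sum>n<2*h. cis (- (2 * pi * ((real n)\<^sup>2 / (4 * c)))) *
        contour_integral (linepath (P a (-R)) (P a R)) (\<lambda>z. chirp c (z + of_real (real n / (2 * c)))))"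
      by (simp add: contour_integral_sum contour_integral_lmul contour_integrable_lmul int3)
    finally show ?thesis by (simp only: Jn)
  qed
  have total: "\<forall>\<^sub>F R in at_top. I (P a (-1 * R)) (P b (-1 * R)) + I (P b (1 * R)) (P a (1 * R)) +
      (\<Sum>n<2*h. cis (- (2 * pi * ((real n)\<^sup>2 / (4 * c)))) * J n R) = G"
    using eventually_gt_at_top[of 0]
  proof eventually_elim
    case (elim R)
    from contour_integral_mordell_kernel[OF this, where c = c and q = q] show ?case
      unfolding vertical[symmetric] G_def I_def P_def a_def b_def by (simp add: algebra_simps)
  qed
  have horizontal: "((\<lambda>R. I (P x (\<sigma> * R)) (P y (\<sigma> * R))) \<longlongrightarrow> 0) at_top" if "\<bar>\<sigma>\<bar> = 1" for \<sigma> x y :: real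
    unfolding I_def P_def
  proof (rule contour_integral_chirp_horizontal_tendsto_0[OF c that, where M = 2])
    show "\<forall>\<^sub>F R in at_top. \<forall>u\<in>closed_segment x y. norm (mordell_kernel c (of_real u + of_real (\<sigma> * R) * (1 + \<i>)))
            \<le> 2 * norm (chirp c (of_real u + of_real (\<sigma> * R) * (1 + \<i>)))"
      using eventually_ge_at_top[of 1]
      by eventually_elim (use mordell_kernel_horizontal_bound[OF that] in blast)
    show "\<forall>\<^sub>F R in at_top. mordell_kernel c contour_integrable_on
       (linepath (of_real x + of_real (\<sigma> * R) * (1 + \<i>)) (of_real y + of_real (\<sigma> * R) * (1 + \<i>)))"
      using eventually_ge_at_top[of 1]
      by eventually_elim (use that in \<open>intro mordell_kernel_contour_integrable horizontal_segment_no_Ints, auto\<close>)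
  qed simp
  have J: "(J n \<longlongrightarrow> (1 + \<i>) / (2 * of_real (sqrt c))) at_top" for n
    unfolding J_def P_def by (rule contour_integral_chirp_tendsto[OF c])
  have "((\<lambda>R. I (P a (-1 * R)) (P b (-1 * R)) + I (P b (1 * R)) (P a (1 * R)) +
      (\<Sum>n<2*h. cis (- (2 * pi * ((real n)\<^sup>2 / (4 * c)))) * J n R)) \<longlongrightarrow>
      0 + 0 + (\<Sum>n<2*h. cis (- (2 * pi * ((real n)\<^sup>2 / (4 * c)))) * ((1 + \<i>) / (2 * of_real (sqrt c))))) at_top"
    by (intro tendsto_intros horizontal J) auto
  from tendsto_cong[OF total, THEN iffD1, OF this]
  have "G = (\<Sum>n<2*h. cis (- (2 * pi * ((real n)\<^sup>2 / (4 * c)))) * ((1 + \<i>) / (2 * of_real (sqrt c))))"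
    by (auto simp: tendsto_const_iff)
  also have "\<dots> = (1 + \<i>) / 2 * of_real (1 / sqrt c) * (\<Sum>n<2*h. cis (- (2 * pi * ((real n)\<^sup>2 / (4 * c)))))"
    by (simp add: sum_distrib_left sum_distrib_right mult_ac)
  also have "1 / sqrt c = sqrt (real q / real h)"
    by (simp add: c_def real_sqrt_divide)
  also have "G = (\<Sum>p<q. cis (2 * pi * (real h * (real p)\<^sup>2 / real q)))"
    unfolding G_def
  proof (intro sum.cong refl)
    fix p
    have "2 * of_real pi * \<i> * of_real c * (of_nat p)\<^sup>2 = \<i> * of_real (2 * pi * (real h * (real p)\<^sup>2 / real q))"
      by (simp add: c_def)
    then show "chirp c (of_nat p) = cis (2 * pi * (real h * (real p)\<^sup>2 / real q))"
      unfolding chirp_def cis_conv_exp by simp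
  qed
  finally show ?thesis by (simp add: c_def)
qed

subsection \<open>Counting by the Fejer kernel\<close>

definition quadratic_count :: "nat \<Rightarrow> real \<Rightarrow> nat" where
  "quadratic_count q \<delta> = card {p. p < q \<and> (\<exists>m::int. \<bar>(real p)\<^sup>2 / real q - of_int m\<bar> < \<delta>)}"

text \<open>The Fejer-weighted average of the Gauss sums after reciprocity, with the factors
  \<open>(1 + \<i>) / 2\<close> and \<open>sqrt q\<close> removed, so that \<open>q\<close> occurs
  only linearly in the exponent. The term \<open>h = 0\<close> is absent because it is the main term
  of the count.\<close>

definition dual_sum :: "nat \<Rightarrow> nat \<Rightarrow> complex" where
  "dual_sum H q = (\<Sum>h\<in>{1..<H}. \<Sum>n<2*h.
     of_real ((real H - real h) / ((real H)\<^sup>2 * sqrt (real h))) * cis (- (2 * pi * ((real n)\<^sup>2 * real q / (4 * real h)))))"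

lemma quadratic_count_mono: "\<delta> \<le> \<epsilon> \<Longrightarrow> quadratic_count q \<delta> \<le> quadratic_count q \<epsilon>"
  unfolding quadratic_count_def by (intro card_mono) (auto intro: order.strict_trans2)

lemma quadratic_count_le: "quadratic_count q \<delta> \<le> q"
proof -
  have "quadratic_count q \<delta> \<le> card {..<q}"
    unfolding quadratic_count_def by (intro card_mono) auto
  then show ?thesis by simp
qed

text \<open>The unnormalised Fejer kernel: among the pairs of indices below \<open>H\<close>, each
  difference \<open>h\<close> occurs \<open>H - h\<close> times with either sign.\<close>

lemma norm_sum_cis_squared:
  "(norm (\<Sum>h<H. cis (real h * x)))\<^sup>2 = real H + 2 * (\<Sum>h\<in>{1..<H}. (real H - real h) * cos (real h * x))"
proof (induction H)
  case (Suc H)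
  let ?S = "\<Sum>h<H. cis (real h * x)"
  have "(norm (?S + cis (real H * x)))\<^sup>2 = (norm ?S)\<^sup>2 + 1 + 2 * Re (?S * cnj (cis (real H * x)))"
    by (simp add: cmod_power2) (use sin_cos_squared_add[of "real H * x"] in \<open>simp add: power2_eq_square algebra_simps\<close>)
  also have "?S * cnj (cis (real H * x)) = (\<Sum>h<H. cis (- (real (H - h) * x)))"
    unfolding sum_distrib_right by (intro sum.cong) (auto simp: cis_mult cis_cnj of_nat_diff algebra_simps)
  also have "\<dots> = (\<Sum>h\<in>{1..<Suc H}. cis (- (real h * x)))"
    by (rule sum.reindex_bij_witness[of _ "\<lambda>h. H - h" "\<lambda>h. H - h"]) auto
  also have "Re \<dots> = (\<Sum>h\<in>{1..<Suc H}. cos (real h * x))"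
    by simp
  also have "(\<Sum>h\<in>{1..<Suc H}. (real (Suc H) - real h) * cos (real h * x))
      = (\<Sum>h\<in>{1..<Suc H}. (real H - real h) * cos (real h * x)) + (\<Sum>h\<in>{1..<Suc H}. cos (real h * x))"
    unfolding sum.distrib [symmetric] by (intro sum.cong) (auto simp: algebra_simps)
  moreover have "(\<Sum>h\<in>{1..<Suc H}. (real H - real h) * cos (real h * x)) = (\<Sum>h\<in>{1..<H}. (real H - real h) * cos (real h * x))"
    by (cases "H = 0") (auto simp: sum.atLeastLessThan_Suc)
  ultimately show ?case
    using Suc.IH by (simp add: algebra_simps)
qed simp

lemma cos_ge_inverse_sqrt2:
  assumes "\<bar>x\<bar> \<le> pi / 4"
  shows "cos x \<ge> 1 / sqrt 2"
proof -
  have "cos (pi / 4) \<le> cos \<bar>x\<bar>"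
    using assms by (intro cos_monotone_0_pi_le) auto
  moreover have "1 / sqrt 2 = sqrt 2 / 2" by (simp add: field_simps)
  ultimately show ?thesis by (simp add: cos_45)
qed

text \<open>The 8 is chosen so that every phase, reduced modulo \<open>2 * pi\<close>, is at most
  \<open>2 * pi * H / (8 * H) = pi / 4\<close> in absolute value. All \<open>H\<close> unit vectors
  then have real part at least \<open>1 / sqrt 2\<close> and cannot cancel.\<close>

lemma fejer_kernel_lower_bound:
  assumes H: "H > 0" and m: "\<bar>\<theta> - of_int m\<bar> < 1 / (8 * real H)"
  shows "(norm (\<Sum>h<H. cis (real h * (2 * pi * \<theta>))))\<^sup>2 \<ge> (real H)\<^sup>2 / 2"
proof -
  have "cos (real h * (2 * pi * \<theta>)) \<ge> 1 / sqrt 2" if "h < H" for h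
  proof -
    have "cos (real h * (2 * pi * \<theta>)) = cos (2 * pi * real h * (\<theta> - of_int m) + 2 * pi * of_int (int h * m))"
      by (simp add: algebra_simps)
    also have "\<dots> = cos (2 * pi * real h * (\<theta> - of_int m))"
      by (simp only: cos_add cos_int_2pin sin_int_2pin mult_1_right mult_zero_right diff_zero)
    also have "\<dots> \<ge> 1 / sqrt 2"
    proof (rule cos_ge_inverse_sqrt2)
      have "real h * \<bar>\<theta> - of_int m\<bar> \<le> real H * (1 / (8 * real H))"
        using that m by (intro mult_mono) auto
      then have "2 * pi * (real h * \<bar>\<theta> - of_int m\<bar>) \<le> 2 * pi * (1 / 8)"
        using H by (intro mult_left_mono) auto
      then show "\<bar>2 * pi * real h * (\<theta> - of_int m)\<bar> \<le> pi / 4"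
        by (simp add: abs_mult mult_ac del: right_diff_distrib_numeral left_diff_distrib_numeral)
    qed
    finally show ?thesis .
  qed
  then have "(\<Sum>h<H. 1 / sqrt 2) \<le> (\<Sum>h<H. cos (real h * (2 * pi * \<theta>)))"
    by (intro sum_mono) auto
  also have "\<dots> = Re (\<Sum>h<H. cis (real h * (2 * pi * \<theta>)))" by simp
  also have "\<dots> \<le> norm (\<Sum>h<H. cis (real h * (2 * pi * \<theta>)))" by (rule complex_Re_le_cmod)
  finally have "(real H / sqrt 2)\<^sup>2 \<le> (norm (\<Sum>h<H. cis (real h * (2 * pi * \<theta>))))\<^sup>2"
    by (intro power_mono) auto
  then show ?thesis by (simp add: power_divide)
qed

lemma dual_sum_eq_gauss_sums:
  assumes "q > 0" "H > 0"
  shows "(\<Sum>h\<in>{1..<H}. of_real (real H - real h) * (\<Sum>p<q. cis (2 * pi * (real h * (real p)\<^sup>2 / real q))))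
     = (1 + \<i>) / 2 * of_real ((real H)\<^sup>2 * sqrt (real q)) * dual_sum H q"
  unfolding dual_sum_def sum_distrib_left
proof (rule sum.cong)
  fix h assume h: "h \<in> {1..<H}"
  have "of_real (real H - real h) * (\<Sum>p<q. cis (2 * pi * (real h * (real p)\<^sup>2 / real q)))
      = (\<Sum>n<2 * h. (1 + \<i>) / 2 * (of_real (real H - real h) * of_real (sqrt (real q / real h))) *
           cis (- (2 * pi * ((real n)\<^sup>2 * real q / (4 * real h)))))"
    using Landsberg_Schaar[of h q] assms h by (simp add: sum_distrib_left mult_ac)
  also have "of_real (real H - real h) * of_real (sqrt (real q / real h)) =
      (of_real ((real H)\<^sup>2 * sqrt (real q)) * of_real ((real H - real h) / ((real H)\<^sup>2 * sqrt (real h))) :: complex)"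
    unfolding of_real_mult [symmetric] using assms by (simp add: real_sqrt_divide)
  finally show "(\<Sum>p<q. of_real (real H - real h) * cis (2 * pi * (real h * (real p)\<^sup>2 / real q))) =
      (\<Sum>n<2 * h. (1 + \<i>) / 2 * of_real ((real H)\<^sup>2 * sqrt (real q)) *
          (of_real ((real H - real h) / ((real H)\<^sup>2 * sqrt (real h))) *
           cis (- (2 * pi * ((real n)\<^sup>2 * real q / (4 * real h))))))"
    by (simp only: mult.assoc sum_distrib_left)
qed simp

lemma quadratic_count_le_dual_sum:
  assumes "q > 0" "H > 0"
  shows "real (quadratic_count q (1 / (8 * real H))) \<le> 2 * real q / real H + 3 * sqrt (real q) * norm (dual_sum H q)"
proof -
  define F where "F = (\<lambda>p::nat. (norm (\<Sum>h<H. cis (real h * (2 * pi * ((real p)\<^sup>2 / real q)))))\<^sup>2)"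
  define P where "P = {p. p < q \<and> (\<exists>m::int. \<bar>(real p)\<^sup>2 / real q - of_int m\<bar> < 1 / (8 * real H))}"
  have "real (card P) * ((real H)\<^sup>2 / 2) = (\<Sum>p\<in>P. (real H)\<^sup>2 / 2)" by simp
  also have "\<dots> \<le> (\<Sum>p\<in>P. F p)"
    unfolding F_def P_def by (intro sum_mono) (use fejer_kernel_lower_bound[OF assms(2)] in blast)
  also have "\<dots> \<le> (\<Sum>p<q. F p)"
    by (intro sum_mono2) (auto simp: P_def F_def)
  also have "\<dots> = real q * real H + 2 * (\<Sum>p<q. \<Sum>h\<in>{1..<H}. (real H - real h) * cos (real h * (2 * pi * ((real p)\<^sup>2 / real q))))"
    unfolding F_def norm_sum_cis_squared by (simp add: sum.distrib sum_distrib_left)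
  also have "(\<Sum>p<q. \<Sum>h\<in>{1..<H}. (real H - real h) * cos (real h * (2 * pi * ((real p)\<^sup>2 / real q))))
     = Re (\<Sum>h\<in>{1..<H}. of_real (real H - real h) * (\<Sum>p<q. cis (2 * pi * (real h * (real p)\<^sup>2 / real q))))"
    by (subst sum.swap) (simp add: sum_distrib_left mult_ac)
  also have "\<dots> = Re ((1 + \<i>) / 2 * of_real ((real H)\<^sup>2 * sqrt (real q)) * dual_sum H q)"
    by (simp only: dual_sum_eq_gauss_sums[OF assms])
  also have "\<dots> \<le> norm ((1 + \<i>) / 2 * of_real ((real H)\<^sup>2 * sqrt (real q)) * dual_sum H q)"
    by (rule complex_Re_le_cmod)
  also have "\<dots> = sqrt 2 / 2 * ((real H)\<^sup>2 * sqrt (real q)) * norm (dual_sum H q)"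
    by (simp add: norm_mult norm_divide cmod_def[of "1 + \<i>"] norm_power abs_mult)
  \<comment> \<open>Rounding \<open>sqrt 2 / 2\<close> up to \<open>3 / 4\<close> makes the final
    constant \<open>2 * (3 / 4) * 2 = 3\<close>.\<close>
  also have "\<dots> \<le> 3 / 4 * ((real H)\<^sup>2 * sqrt (real q)) * norm (dual_sum H q)"
  proof -
    have "sqrt 2 \<le> 3 / 2" by (rule real_le_lsqrt) (auto simp: power2_eq_square)
    then show ?thesis by (intro mult_right_mono mult_nonneg_nonneg) auto
  qed
  finally have "real (card P) * ((real H)\<^sup>2 / 2) \<le> real q * real H + 3 / 2 * ((real H)\<^sup>2 * sqrt (real q)) * norm (dual_sum H q)"
    by simp
  then have "real (card P) * ((real H)\<^sup>2 / 2) * (2 / (real H)\<^sup>2)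
     \<le> (real q * real H + 3 / 2 * ((real H)\<^sup>2 * sqrt (real q)) * norm (dual_sum H q)) * (2 / (real H)\<^sup>2)"
    by (rule mult_right_mono) simp
  also have "\<dots> = 2 * real q / real H + 3 * sqrt (real q) * norm (dual_sum H q)"
    using assms(2) by (simp add: distrib_right add_divide_distrib power2_eq_square)
  also have "real (card P) * ((real H)\<^sup>2 / 2) * (2 / (real H)\<^sup>2) = real (card P)"
    using assms(2) by simp
  finally have "real (card P) \<le> 2 * real q / real H + 3 * sqrt (real q) * norm (dual_sum H q)" .
  moreover have "quadratic_count q (1 / (8 * real H)) = card P"
    by (simp only: quadratic_count_def P_def)
  ultimately show ?thesis
    by simp
qed

text \<open>The triangle inequality alone: each \<open>h\<close> has \<open>2 * h\<close> terms of
  weight at most \<open>1 / (H * sqrt h)\<close>, and there are fewer than \<open>H\<close> values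
  of \<open>h\<close>. This is all that short lengths need.\<close>

lemma norm_dual_sum_le: "norm (dual_sum H q) \<le> 2 * sqrt (real H)"
proof (cases "H = 0")
  case False
  have "norm (dual_sum H q) \<le> (\<Sum>h\<in>{1..<H}. \<Sum>n<2*h. (real H - real h) / ((real H)\<^sup>2 * sqrt (real h)))"
    unfolding dual_sum_def
    by (intro sum_norm_le) (simp only: norm_mult norm_of_real norm_cis, simp)
  also have "\<dots> = (\<Sum>h\<in>{1..<H}. 2 * real h * ((real H - real h) / ((real H)\<^sup>2 * sqrt (real h))))"
    by simp
  also have "\<dots> \<le> (\<Sum>h\<in>{1..<H}. 2 * sqrt (real H) / real H)"
  proof (rule sum_mono)
    fix h assume h: "h \<in> {1..<H}"
    have "2 * real h * ((real H - real h) / ((real H)\<^sup>2 * sqrt (real h))) = 2 * sqrt (real h) * ((real H - real h) / (real H)\<^sup>2)"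
    proof -
      have "real h / sqrt (real h) = sqrt (real h)"
        by (simp add: real_div_sqrt)
      then have "2 * sqrt (real h) * ((real H - real h) / (real H)\<^sup>2) = 2 * (real h / sqrt (real h)) * ((real H - real h) / (real H)\<^sup>2)"
        by simp
      also have "\<dots> = 2 * real h * ((real H - real h) / ((real H)\<^sup>2 * sqrt (real h)))"
        by (simp add: mult_ac)
      finally show ?thesis ..
    qed
    also have "\<dots> \<le> 2 * sqrt (real H) * (real H / (real H)\<^sup>2)"
      using h by (intro mult_mono divide_right_mono) auto
    finally show "2 * real h * ((real H - real h) / ((real H)\<^sup>2 * sqrt (real h))) \<le> 2 * sqrt (real H) / real H"
      using False by (simp add: power2_eq_square)
  qed
  also have "\<dots> \<le> 2 * sqrt (real H)"
    using False by (simp add: field_simps)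
  finally show ?thesis .
qed (simp add: dual_sum_def)

subsection \<open>The large sieve\<close>

lemma sin_pi_ge_linear:
  assumes "0 \<le> t" "t \<le> 1 / 2"
  shows "t \<le> sin (pi * t)"
proof -
  have "concave_on {0..pi} sin"
    by (rule f''_le0_imp_concave[where f' = cos and f'' = "\<lambda>x. - sin x"])
       (auto intro!: derivative_eq_intros sin_ge_zero)
  from concave_onD[OF this, of "2 * t" 0 "pi / 2"] have "2 * t \<le> sin (pi * t)"
    using assms by (simp add: mult_ac)
  then show ?thesis using assms by simp
qed

text \<open>The usual bound by the inverse distance of \<open>t\<close> to the nearest integer,
  relaxed to a sum over both neighbouring integers so that the two parts can later be summed
  separately.\<close>

lemma norm_geometric_cis_sum:
  fixes t :: real and Q M :: nat
  assumes "0 < t" "t < 1"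
  shows "norm (\<Sum>q\<in>{Q..<Q + M}. cis (2 * pi * (t * real q))) \<le> 1 / t + 1 / (1 - t)"
proof -
  define z where "z = cis (2 * pi * t)"
  have pow: "cis (2 * pi * (t * real q)) = z ^ q" for q
    by (simp add: z_def Complex.DeMoivre mult_ac)
  have dist: "norm (1 - z) = 2 * sin (pi * t)"
  proof -
    have "(norm (1 - cis y))\<^sup>2 = 2 - 2 * cos y" for y
      unfolding cmod_power2 using sin_cos_squared_add[of y] by (simp add: power2_eq_square algebra_simps)
    then have "(norm (1 - z))\<^sup>2 = 2 - 2 * cos (2 * (pi * t))"
      by (simp add: z_def mult.assoc)
    also have "\<dots> = (2 * sin (pi * t))\<^sup>2"
      by (simp only: cos_double_sin) (simp add: power_mult_distrib)
    finally have "(norm (1 - z))\<^sup>2 = (2 * sin (pi * t))\<^sup>2" .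
    moreover have "sin (pi * t) \<ge> 0" using assms by (intro sin_ge_zero) auto
    ultimately show ?thesis by (auto intro: power2_eq_imp_eq)
  qed
  have sin: "sin (pi * t) \<ge> min t (1 - t)"
  proof (cases "t \<le> 1 / 2")
    case True
    then show ?thesis using sin_pi_ge_linear[of t] assms by simp
  next
    case False
    then have "1 - t \<le> sin (pi * (1 - t))" using assms by (intro sin_pi_ge_linear) auto
    also have "sin (pi * (1 - t)) = sin (pi * t)" by (simp add: right_diff_distrib sin_diff)
    finally show ?thesis by simp
  qed
  have pos: "sin (pi * t) > 0" using sin assms by linarith
  then have z: "z \<noteq> 1" using dist by auto
  have "(\<Sum>q\<in>{Q..<Q + M}. cis (2 * pi * (t * real q))) = z ^ Q * (\<Sum>q<M. z ^ q)"
    unfolding pow sum_distrib_left power_add [symmetric]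
    by (rule sum.reindex_bij_witness[of _ "\<lambda>q. Q + q" "\<lambda>q. q - Q"]) auto
  also have "norm \<dots> = norm (1 - z ^ M) / norm (1 - z)"
    using z by (simp add: norm_mult norm_power z_def sum_gp_strict norm_divide)
  also have "\<dots> \<le> 2 / norm (1 - z)"
    using norm_triangle_ineq4[of 1 "z ^ M"] by (intro divide_right_mono) (auto simp: z_def norm_power)
  also have "\<dots> = 1 / sin (pi * t)" by (simp add: dist)
  also have "\<dots> \<le> 1 / min t (1 - t)"
    using sin assms by (intro divide_left_mono mult_pos_pos) (auto simp: pos)
  also have "\<dots> \<le> 1 / t + 1 / (1 - t)"
    using assms by (auto simp: min_def)
  finally show ?thesis .
qed

text \<open>Separation by \<open>1 / D\<close> makes the integers
  \<lfloor>\<open>D * g x\<close>\<rfloor> distinct members of \<open>{1..D}\<close>, so the sum is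
  dominated by \<open>D\<close> times a harmonic sum.\<close>

lemma sum_inverse_separated_le_harm:
  fixes g :: "'a \<Rightarrow> real" and D :: nat
  assumes "finite X" "D > 0"
    and range: "\<And>x. x \<in> X \<Longrightarrow> 1 / real D \<le> g x \<and> g x \<le> 1"
    and sep: "\<And>x y. x \<in> X \<Longrightarrow> y \<in> X \<Longrightarrow> x \<noteq> y \<Longrightarrow> 1 / real D \<le> \<bar>g x - g y\<bar>"
  shows "(\<Sum>x\<in>X. 1 / g x) \<le> real D * harm D"
proof -
  define k where "k = (\<lambda>x. nat \<lfloor>real D * g x\<rfloor>)"
  have k: "k x \<in> {1..D}" "real (k x) \<le> real D * g x" if "x \<in> X" for x
  proof -
    have "1 \<le> real D * g x" "real D * g x \<le> real D" using range[OF that] assms(2) by (auto simp: field_simps)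
    then show "k x \<in> {1..D}" "real (k x) \<le> real D * g x" unfolding k_def by (auto simp: le_nat_iff le_floor_iff floor_le_iff nat_le_iff)
  qed
  have inj: "inj_on k X"
  proof (rule inj_onI, rule ccontr)
    fix x y assume xy: "x \<in> X" "y \<in> X" "k x = k y" "x \<noteq> y"
    have "1 \<le> real D * \<bar>g x - g y\<bar>" using sep[OF xy(1,2,4)] assms(2) by (simp add: field_simps)
    then have "1 \<le> \<bar>real D * g x - real D * g y\<bar>" by (simp add: abs_mult flip: right_diff_distrib)
    moreover have "real D * g x < real (k x) + 1" "real D * g y < real (k y) + 1"
      by (auto simp: k_def) linarith+
    ultimately show False using k(2)[OF xy(1)] k(2)[OF xy(2)] xy(3) by linarith
  qed
  have "(\<Sum>x\<in>X. 1 / g x) \<le> (\<Sum>x\<in>X. real D * inverse (real (k x)))"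
  proof (rule sum_mono)
    fix x assume x: "x \<in> X"
    have "0 < g x" using range[OF x] assms(2) by (auto intro: less_le_trans[of _ "1 / real D"])
    then show "1 / g x \<le> real D * inverse (real (k x))"
      using k[OF x] by (simp add: field_simps)
  qed
  also have "\<dots> = real D * (\<Sum>j\<in>k ` X. inverse (real j))"
    by (simp add: sum_distrib_left sum.reindex[OF inj])
  also have "\<dots> \<le> real D * (\<Sum>j\<in>{1..D}. inverse (real j))"
    using k(1) by (intro mult_left_mono sum_mono2) auto
  finally show ?thesis by (simp add: harm_def)
qed

text \<open>On one side of \<beta> the distance to \<beta> is monotone, so distinct points have
  separated distances. Two sides and two kinds of terms give the factor 4.\<close>

lemma separated_row_sum_le:
  fixes A :: "real set" and D :: nat
  assumes A: "finite A" and D: "D > 0"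
    and sep: "\<And>\<beta> \<gamma>. \<beta> \<in> A \<Longrightarrow> \<gamma> \<in> A \<Longrightarrow> \<beta> \<noteq> \<gamma> \<Longrightarrow> 1 / real D \<le> \<bar>\<beta> - \<gamma>\<bar> \<and> \<bar>\<beta> - \<gamma>\<bar> \<le> 1 - 1 / real D"
    and \<beta>: "\<beta> \<in> A"
  shows "(\<Sum>\<gamma>\<in>A - {\<beta>}. 1 / \<bar>\<beta> - \<gamma>\<bar> + 1 / (1 - \<bar>\<beta> - \<gamma>\<bar>)) \<le> 4 * real D * harm D"
proof -
  define X where "X = {\<gamma>\<in>A. \<gamma> < \<beta>}"
  define Y where "Y = {\<gamma>\<in>A. \<beta> < \<gamma>}"
  have D1: "0 \<le> 1 / real D" by simp
  have XY: "A - {\<beta>} = X \<union> Y" "X \<inter> Y = {}" "finite X" "finite Y"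
    using A by (auto simp: X_def Y_def)
  have bound: "(\<Sum>\<gamma>\<in>Z. 1 / \<bar>\<beta> - \<gamma>\<bar> + 1 / (1 - \<bar>\<beta> - \<gamma>\<bar>)) \<le> 2 * (real D * harm D)"
    if Z: "Z = X \<or> Z = Y" for Z
  proof -
    have sub: "Z \<subseteq> A - {\<beta>}" "finite Z" using Z XY by auto
    have diff: "\<bar>\<bar>\<beta> - \<gamma>\<bar> - \<bar>\<beta> - \<gamma>'\<bar>\<bar> = \<bar>\<gamma> - \<gamma>'\<bar>" if "\<gamma> \<in> Z" "\<gamma>' \<in> Z" for \<gamma> \<gamma>'
      using that Z by (auto simp: X_def Y_def)
    have "(\<Sum>\<gamma>\<in>Z. 1 / \<bar>\<beta> - \<gamma>\<bar>) \<le> real D * harm D"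
    proof (rule sum_inverse_separated_le_harm[OF sub(2) D])
      fix \<gamma> assume "\<gamma> \<in> Z"
      then have "\<gamma> \<in> A" "\<beta> \<noteq> \<gamma>" using sub by auto
      then show "1 / real D \<le> \<bar>\<beta> - \<gamma>\<bar> \<and> \<bar>\<beta> - \<gamma>\<bar> \<le> 1"
        using sep[OF \<beta>, of \<gamma>] D1 by linarith
    next
      fix \<gamma> \<gamma>' assume "\<gamma> \<in> Z" "\<gamma>' \<in> Z" "\<gamma> \<noteq> \<gamma>'"
      then show "1 / real D \<le> \<bar>\<bar>\<beta> - \<gamma>\<bar> - \<bar>\<beta> - \<gamma>'\<bar>\<bar>"
        using sep[of \<gamma> \<gamma>'] sub by (auto simp: diff)
    qed
    moreover have "(\<Sum>\<gamma>\<in>Z. 1 / (1 - \<bar>\<beta> - \<gamma>\<bar>)) \<le> real D * harm D"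
    proof (rule sum_inverse_separated_le_harm[OF sub(2) D])
      fix \<gamma> assume "\<gamma> \<in> Z"
      then have "\<gamma> \<in> A" "\<beta> \<noteq> \<gamma>" using sub by auto
      then show "1 / real D \<le> 1 - \<bar>\<beta> - \<gamma>\<bar> \<and> 1 - \<bar>\<beta> - \<gamma>\<bar> \<le> 1"
        using sep[OF \<beta>, of \<gamma>] by linarith
    next
      fix \<gamma> \<gamma>' assume g: "\<gamma> \<in> Z" "\<gamma>' \<in> Z" "\<gamma> \<noteq> \<gamma>'"
      have "\<bar>(1 - \<bar>\<beta> - \<gamma>\<bar>) - (1 - \<bar>\<beta> - \<gamma>'\<bar>)\<bar> = \<bar>\<bar>\<beta> - \<gamma>\<bar> - \<bar>\<beta> - \<gamma>'\<bar>\<bar>" by linarith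
      then show "1 / real D \<le> \<bar>(1 - \<bar>\<beta> - \<gamma>\<bar>) - (1 - \<bar>\<beta> - \<gamma>'\<bar>)\<bar>"
        using sep[of \<gamma> \<gamma>'] sub g diff[OF g(1,2)] by auto
    qed
    ultimately show ?thesis by (simp add: sum.distrib)
  qed
  have "(\<Sum>\<gamma>\<in>A - {\<beta>}. 1 / \<bar>\<beta> - \<gamma>\<bar> + 1 / (1 - \<bar>\<beta> - \<gamma>\<bar>)) =
     (\<Sum>\<gamma>\<in>X. 1 / \<bar>\<beta> - \<gamma>\<bar> + 1 / (1 - \<bar>\<beta> - \<gamma>\<bar>)) + (\<Sum>\<gamma>\<in>Y. 1 / \<bar>\<beta> - \<gamma>\<bar> + 1 / (1 - \<bar>\<beta> - \<gamma>\<bar>))"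
    unfolding XY(1) by (rule sum.union_disjoint[OF XY(3,4,2)])
  also have "\<dots> \<le> 4 * real D * harm D"
    using bound[of X] bound[of Y] by simp
  finally show ?thesis .
qed

text \<open>Separation is meant modulo 1, hence the upper bound on the distance as well as the lower
  one. Expanding the square leads to a symmetric Gram matrix, and its row sums bound the quadratic
  form: the diagonal gives \<open>M\<close>, the geometric sums off the diagonal give the
  rest.\<close>

lemma large_sieve:
  fixes A :: "real set" and c :: "real \<Rightarrow> real" and D Q M :: nat
  assumes A: "finite A" and D: "D > 0"
    and sep: "\<And>\<beta> \<gamma>. \<beta> \<in> A \<Longrightarrow> \<gamma> \<in> A \<Longrightarrow> \<beta> \<noteq> \<gamma> \<Longrightarrow> 1 / real D \<le> \<bar>\<beta> - \<gamma>\<bar> \<and> \<bar>\<beta> - \<gamma>\<bar> \<le> 1 - 1 / real D"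
  shows "(\<Sum>q\<in>{Q..<Q + M}. (norm (\<Sum>\<beta>\<in>A. of_real (c \<beta>) * cis (- (2 * pi * (\<beta> * real q)))))\<^sup>2)
       \<le> (real M + 4 * real D * harm D) * (\<Sum>\<beta>\<in>A. (c \<beta>)\<^sup>2)"
proof -
  define K where "K = (\<lambda>\<beta> \<gamma> :: real. norm (\<Sum>q\<in>{Q..<Q + M}. cis (2 * pi * ((\<gamma> - \<beta>) * real q))))"
  have K_sym: "K \<beta> \<gamma> = K \<gamma> \<beta>" for \<beta> \<gamma>
  proof -
    have "(\<Sum>q\<in>{Q..<Q + M}. cis (2 * pi * ((\<gamma> - \<beta>) * real q))) = cnj (\<Sum>q\<in>{Q..<Q + M}. cis (2 * pi * ((\<beta> - \<gamma>) * real q)))"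
      by (simp add: cis_cnj algebra_simps)
    then show ?thesis unfolding K_def by (simp only: complex_mod_cnj)
  qed
  have norm_sq: "(norm z)\<^sup>2 = Re (z * cnj z)" for z :: complex
    unfolding cmod_power2 by (simp add: power2_eq_square)
  have expand: "(norm (\<Sum>\<beta>\<in>A. of_real (c \<beta>) * cis (- (2 * pi * (\<beta> * real q)))))\<^sup>2
      = Re (\<Sum>\<beta>\<in>A. \<Sum>\<gamma>\<in>A. of_real (c \<beta> * c \<gamma>) * cis (2 * pi * ((\<gamma> - \<beta>) * real q)))" for q :: nat
  proof -
    have "(norm (\<Sum>\<beta>\<in>A. of_real (c \<beta>) * cis (- (2 * pi * (\<beta> * real q)))))\<^sup>2
       = Re ((\<Sum>\<beta>\<in>A. of_real (c \<beta>) * cis (- (2 * pi * (\<beta> * real q)))) * cnj (\<Sum>\<beta>\<in>A. of_real (c \<beta>) * cis (- (2 * pi * (\<beta> * real q)))))"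
      by (rule norm_sq)
    also have "(\<Sum>\<beta>\<in>A. of_real (c \<beta>) * cis (- (2 * pi * (\<beta> * real q)))) * cnj (\<Sum>\<beta>\<in>A. of_real (c \<beta>) * cis (- (2 * pi * (\<beta> * real q))))
       = (\<Sum>\<beta>\<in>A. \<Sum>\<gamma>\<in>A. of_real (c \<beta> * c \<gamma>) * cis (2 * pi * ((\<gamma> - \<beta>) * real q)))"
      unfolding cnj_sum sum_product
    proof (intro sum.cong refl)
      fix \<beta> \<gamma>
      have "cis (- (2 * pi * (\<beta> * real q))) * cis (2 * pi * (\<gamma> * real q)) = cis (2 * pi * ((\<gamma> - \<beta>) * real q))"
        by (simp add: cis_mult algebra_simps)
      then show "of_real (c \<beta>) * cis (- (2 * pi * (\<beta> * real q))) * cnj (of_real (c \<gamma>) * cis (- (2 * pi * (\<gamma> * real q))))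
         = of_real (c \<beta> * c \<gamma>) * cis (2 * pi * ((\<gamma> - \<beta>) * real q))"
        by (simp add: cis_cnj mult_ac)
    qed
    finally show ?thesis .
  qed
  have "(\<Sum>q\<in>{Q..<Q + M}. (norm (\<Sum>\<beta>\<in>A. of_real (c \<beta>) * cis (- (2 * pi * (\<beta> * real q)))))\<^sup>2)
     = Re (\<Sum>\<beta>\<in>A. \<Sum>\<gamma>\<in>A. of_real (c \<beta> * c \<gamma>) * (\<Sum>q\<in>{Q..<Q + M}. cis (2 * pi * ((\<gamma> - \<beta>) * real q))))"
  proof -
    have "(\<Sum>q\<in>{Q..<Q + M}. \<Sum>\<beta>\<in>A. \<Sum>\<gamma>\<in>A. of_real (c \<beta> * c \<gamma>) * cis (2 * pi * ((\<gamma> - \<beta>) * real q)))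
       = (\<Sum>\<beta>\<in>A. \<Sum>\<gamma>\<in>A. of_real (c \<beta> * c \<gamma>) * (\<Sum>q\<in>{Q..<Q + M}. cis (2 * pi * ((\<gamma> - \<beta>) * real q))))"
      unfolding sum_distrib_left by (subst sum.swap, intro sum.cong refl, rule sum.swap)
    then show ?thesis unfolding expand Re_sum [symmetric] by (rule arg_cong)
  qed
  also have "\<dots> \<le> norm (\<Sum>\<beta>\<in>A. \<Sum>\<gamma>\<in>A. of_real (c \<beta> * c \<gamma>) * (\<Sum>q\<in>{Q..<Q + M}. cis (2 * pi * ((\<gamma> - \<beta>) * real q))))"
    by (rule complex_Re_le_cmod)
  also have "\<dots> \<le> (\<Sum>\<beta>\<in>A. \<Sum>\<gamma>\<in>A. \<bar>c \<beta> * c \<gamma>\<bar> * K \<beta> \<gamma>)"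
    by (intro sum_norm_le) (simp only: norm_mult norm_of_real K_def order_refl)
  \<comment> \<open>The product of coefficients is replaced by a mean of squares; since
    \<open>K\<close> is symmetric, both halves reduce to the same sum over rows.\<close>
  also have "\<dots> \<le> (\<Sum>\<beta>\<in>A. \<Sum>\<gamma>\<in>A. ((c \<beta>)\<^sup>2 / 2 + (c \<gamma>)\<^sup>2 / 2) * K \<beta> \<gamma>)"
  proof (intro sum_mono mult_right_mono)
    fix \<beta> \<gamma>
    have "2 * (\<bar>c \<beta>\<bar> * \<bar>c \<gamma>\<bar>) \<le> \<bar>c \<beta>\<bar>\<^sup>2 + \<bar>c \<gamma>\<bar>\<^sup>2"
      using sum_squares_bound[of "\<bar>c \<beta>\<bar>" "\<bar>c \<gamma>\<bar>"] by simp
    then show "\<bar>c \<beta> * c \<gamma>\<bar> \<le> (c \<beta>)\<^sup>2 / 2 + (c \<gamma>)\<^sup>2 / 2" by (simp add: abs_mult)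
  qed (simp add: K_def)
  also have "\<dots> = (\<Sum>\<beta>\<in>A. \<Sum>\<gamma>\<in>A. (c \<beta>)\<^sup>2 / 2 * K \<beta> \<gamma>) + (\<Sum>\<beta>\<in>A. \<Sum>\<gamma>\<in>A. (c \<gamma>)\<^sup>2 / 2 * K \<beta> \<gamma>)"
    by (simp add: distrib_right sum.distrib)
  also have "(\<Sum>\<beta>\<in>A. \<Sum>\<gamma>\<in>A. (c \<gamma>)\<^sup>2 / 2 * K \<beta> \<gamma>) = (\<Sum>\<beta>\<in>A. \<Sum>\<gamma>\<in>A. (c \<beta>)\<^sup>2 / 2 * K \<beta> \<gamma>)"
    by (subst sum.swap) (simp add: K_sym)
  also have "(\<Sum>\<beta>\<in>A. \<Sum>\<gamma>\<in>A. (c \<beta>)\<^sup>2 / 2 * K \<beta> \<gamma>) + (\<Sum>\<beta>\<in>A. \<Sum>\<gamma>\<in>A. (c \<beta>)\<^sup>2 / 2 * K \<beta> \<gamma>) = (\<Sum>\<beta>\<in>A. (c \<beta>)\<^sup>2 * (\<Sum>\<gamma>\<in>A. K \<beta> \<gamma>))"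
    unfolding sum.distrib [symmetric] sum_distrib_left
    by (intro sum.cong refl) simp
  also have "\<dots> \<le> (\<Sum>\<beta>\<in>A. (c \<beta>)\<^sup>2 * (real M + 4 * real D * harm D))"
  proof (intro sum_mono mult_left_mono)
    fix \<beta> assume \<beta>: "\<beta> \<in> A"
    have K_bound: "K \<beta> \<gamma> \<le> 1 / \<bar>\<beta> - \<gamma>\<bar> + 1 / (1 - \<bar>\<beta> - \<gamma>\<bar>)" if "\<gamma> \<in> A - {\<beta>}" for \<gamma>
    proof -
      have "1 / real D > 0" using D by simp
      moreover have "\<gamma> \<in> A" "\<beta> \<noteq> \<gamma>" using that by auto
      ultimately have t: "0 < \<bar>\<beta> - \<gamma>\<bar>" "\<bar>\<beta> - \<gamma>\<bar> < 1" using sep[OF \<beta>, of \<gamma>] by linarith+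
      have "K \<beta> \<gamma> = norm (\<Sum>q\<in>{Q..<Q + M}. cis (2 * pi * (\<bar>\<beta> - \<gamma>\<bar> * real q)))"
      proof (cases "\<gamma> \<ge> \<beta>")
        case True then show ?thesis unfolding K_def by simp
      next
        case False then show ?thesis unfolding K_sym[of \<beta>] unfolding K_def by simp
      qed
      then show ?thesis using norm_geometric_cis_sum[OF t] by simp
    qed
    have "(\<Sum>\<gamma>\<in>A. K \<beta> \<gamma>) = K \<beta> \<beta> + (\<Sum>\<gamma>\<in>A - {\<beta>}. K \<beta> \<gamma>)"
      using A \<beta> by (rule sum.remove)
    also have "K \<beta> \<beta> = real M" by (simp add: K_def)
    also have "(\<Sum>\<gamma>\<in>A - {\<beta>}. K \<beta> \<gamma>) \<le> (\<Sum>\<gamma>\<in>A - {\<beta>}. 1 / \<bar>\<beta> - \<gamma>\<bar> + 1 / (1 - \<bar>\<beta> - \<gamma>\<bar>))"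
      by (intro sum_mono K_bound)
    also have "\<dots> \<le> 4 * real D * harm D"
      using A D sep \<beta> by (rule separated_row_sum_le)
    finally show "(\<Sum>\<gamma>\<in>A. K \<beta> \<gamma>) \<le> real M + 4 * real D * harm D" by simp
  qed simp
  also have "\<dots> = (\<Sum>\<beta>\<in>A. (c \<beta>)\<^sup>2) * (real M + 4 * real D * harm D)"
    by (rule sum_distrib_right [symmetric])
  finally show ?thesis
    by (simp only: mult.commute[of "real M + 4 * real D * harm D"])
qed

subsection \<open>Solutions of quadratic congruences\<close>

lemma card_multiples_le:
  assumes "d > 0"
  shows "real (card {m \<in> {1..N}. d dvd m}) \<le> real N / real d"
proof -
  have "{m \<in> {1..N}. d dvd m} \<subseteq> (\<lambda>k. d * k) ` {1..N div d}"
  proof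
    fix m assume "m \<in> {m \<in> {1..N}. d dvd m}"
    then obtain k where k: "m = d * k" "1 \<le> m" "m \<le> N" by auto
    then have "k \<in> {1..N div d}" using assms by (auto simp: less_eq_div_iff_mult_less_eq mult_ac Suc_le_eq)
    then show "m \<in> (\<lambda>k. d * k) ` {1..N div d}" using k by auto
  qed
  from surj_card_le[OF finite_atLeastAtMost this] have "card {m \<in> {1..N}. d dvd m} \<le> N div d"
    by simp
  then have "real (card {m \<in> {1..N}. d dvd m}) \<le> real (N div d)" by simp
  also have "\<dots> \<le> real N / real d" by (simp add: of_nat_div_le_of_nat)
  finally show ?thesis .
qed

text \<open>If a prime has exponent \<open>e\<close> in \<open>h\<close>, its exponent in
  \<open>m\<close> is at least \<open>e / 2\<close> rounded up, which is
  \<open>e mod 2 + e div 2\<close>; the two summands are its exponents in the squarefree and the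
  square part.\<close>

lemma square_dvd_imp_dvd:
  fixes h m :: nat
  assumes "h dvd m\<^sup>2"
  shows "squarefree_part h * square_part h dvd m"
proof (cases "m = 0")
  case False
  then have h: "h \<noteq> 0" using assms by (intro notI) auto
  show ?thesis
  proof (rule multiplicity_le_imp_dvd)
    show "squarefree_part h * square_part h \<noteq> 0" using h by simp
    fix p :: nat assume p: "prime p"
    have "multiplicity p h \<le> multiplicity p (m\<^sup>2)"
      using assms False by (intro dvd_imp_multiplicity_le) auto
    also have "\<dots> = 2 * multiplicity p m"
      using p False by (simp add: prime_elem_multiplicity_power_distrib)
    finally have "multiplicity p h \<le> 2 * multiplicity p m" .
    moreover have "multiplicity p (squarefree_part h * square_part h) = multiplicity p h mod 2 + multiplicity p h div 2"
      using p h by (simp add: prime_elem_multiplicity_mult_distrib prime_multiplicity_squarefree_part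
          prime_multiplicity_square_part)
    ultimately show "multiplicity p (squarefree_part h * square_part h) \<le> multiplicity p m" by presburger
  qed
qed simp

text \<open>Multiplying by \<open>r\<close> turns the condition into \<open>h dvd (r * n)^2\<close>,
  so \<open>r * n\<close> is a multiple of \<open>k = h / square_part h\<close>. Below
  \<open>2 * r * h\<close> there are only \<open>2 * r * square_part h\<close> such
  multiples.\<close>

lemma card_quadratic_congruence_zero_le:
  fixes h r :: nat
  assumes "h > 0" "r > 0"
  shows "card {n. n < 2 * h \<and> h dvd r * n\<^sup>2} \<le> 2 * r * square_part h"
proof -
  define k where "k = squarefree_part h * square_part h"
  have h: "h = k * square_part h"
    unfolding k_def using squarefree_decompose[of h, symmetric] by (simp add: power2_eq_square mult.assoc)
  have k: "k > 0" using assms(1) h by (intro gr0I) simp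
  have kdvd: "k dvd r * n" if "h dvd r * n\<^sup>2" for n
  proof -
    have "(r * n)\<^sup>2 = r * (r * n\<^sup>2)" by (simp add: power2_eq_square mult_ac)
    then have "h dvd (r * n)\<^sup>2" using that by simp
    then show ?thesis unfolding k_def by (rule square_dvd_imp_dvd)
  qed
  have "inj_on (\<lambda>n. r * n div k) {n. n < 2 * h \<and> h dvd r * n\<^sup>2}"
  proof (rule inj_onI)
    fix n n' assume "n \<in> {n. n < 2 * h \<and> h dvd r * n\<^sup>2}" "n' \<in> {n. n < 2 * h \<and> h dvd r * n\<^sup>2}"
      "r * n div k = r * n' div k"
    then have "r * n = r * n'" using kdvd[of n] kdvd[of n'] by (metis (mono_tags, lifting) dvd_div_mult_self mem_Collect_eq)
    then show "n = n'" using assms(2) by simp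
  qed
  moreover have "(\<lambda>n. r * n div k) ` {n. n < 2 * h \<and> h dvd r * n\<^sup>2} \<subseteq> {..<2 * r * square_part h}"
  proof
    fix y assume "y \<in> (\<lambda>n. r * n div k) ` {n. n < 2 * h \<and> h dvd r * n\<^sup>2}"
    then obtain n where n: "y = r * n div k" "n < 2 * h" by auto
    have "r * n < r * (2 * (k * square_part h))" using n(2) assms(2) h by simp
    then have "y < 2 * r * square_part h"
      unfolding n(1) using k by (simp add: div_less_iff_less_mult mult_ac)
    then show "y \<in> {..<2 * r * square_part h}" by simp
  qed
  ultimately have "card {n. n < 2 * h \<and> h dvd r * n\<^sup>2} \<le> card {..<2 * r * square_part h}"
    by (intro card_inj_on_le) auto
  then show ?thesis by simp
qed

lemma sum_inverse_sqrt_le: "(\<Sum>u\<in>{1..n}. 1 / sqrt (real u)) \<le> 2 * sqrt (real n)"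
proof (induction n)
  case (Suc n)
  have "sqrt (real n) * sqrt (real (Suc n)) \<le> (real n + real (Suc n)) / 2"
    using arith_geo_mean_sqrt[of "real n" "real (Suc n)"] by (simp add: real_sqrt_mult)
  then have "1 \<le> 2 * (sqrt (real (Suc n)) * sqrt (real (Suc n)) - sqrt (real n) * sqrt (real (Suc n)))"
    by simp
  then have "1 \<le> 2 * (sqrt (real (Suc n)) - sqrt (real n)) * sqrt (real (Suc n))"
    by (simp only: left_diff_distrib right_diff_distrib mult.assoc)
  then have "1 / sqrt (real (Suc n)) \<le> 2 * (sqrt (real (Suc n)) - sqrt (real n))"
    by (subst pos_divide_le_eq) auto
  then show ?case using Suc by simp
qed simp

text \<open>Writing \<open>h = u * s^2\<close> with \<open>u\<close> squarefree turns the summand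
  into \<open>1 / sqrt u\<close>. For fixed \<open>s\<close> the sum over
  \<open>u \<le> H / s^2\<close> is at most \<open>2 * sqrt H / s\<close>, and summing over
  \<open>s\<close> costs only a logarithm.\<close>

lemma sum_square_part_le:
  "(\<Sum>h\<in>{1..<H}. real (square_part h) / sqrt (real h)) \<le> 2 * sqrt (real H) * harm H"
proof -
  let ?f = "\<lambda>h::nat. (square_part h, squarefree_part h)"
  let ?B = "Sigma {1..H} (\<lambda>s. {1..H div s\<^sup>2})"
  have "(\<Sum>h\<in>{1..<H}. real (square_part h) / sqrt (real h)) = (\<Sum>h\<in>{1..<H}. 1 / sqrt (real (squarefree_part h)))"
  proof (rule sum.cong)
    fix h :: nat assume h: "h \<in> {1..<H}"
    have "real (squarefree_part h) * (real (square_part h))\<^sup>2 = real h"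
      by (metis of_nat_mult of_nat_power squarefree_decompose)
    then have "sqrt (real h) = sqrt (real (squarefree_part h) * (real (square_part h))\<^sup>2)"
      by simp
    then have "sqrt (real h) = sqrt (real (squarefree_part h)) * real (square_part h)"
      by (simp add: real_sqrt_mult)
    then show "real (square_part h) / sqrt (real h) = 1 / sqrt (real (squarefree_part h))"
      using h by simp
  qed simp
  also have "\<dots> = (\<Sum>(s, u)\<in>?f ` {1..<H}. 1 / sqrt (real u))"
    by (subst sum.reindex) (auto intro!: inj_onI squarefree_decomposition_unique)
  also have "\<dots> \<le> (\<Sum>(s, u)\<in>?B. 1 / sqrt (real u))"
  proof (rule sum_mono2)
    show "?f ` {1..<H} \<subseteq> ?B"
    proof
      fix x assume "x \<in> ?f ` {1..<H}"
      then obtain h where h: "x = ?f h" "1 \<le> h" "h < H" by auto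
      have pos: "square_part h > 0" "squarefree_part h > 0"
        using h by (auto intro: gr0I)
      have eq: "squarefree_part h * (square_part h)\<^sup>2 = h" by (rule squarefree_decompose[symmetric])
      have "square_part h \<le> (square_part h)\<^sup>2" using pos by (simp add: power2_eq_square)
      also have "\<dots> \<le> h" using h by (intro dvd_imp_le) auto
      finally have "square_part h \<le> H" using h by simp
      moreover have "squarefree_part h \<le> H div (square_part h)\<^sup>2"
        using pos eq h by (simp add: less_eq_div_iff_mult_less_eq)
      ultimately show "x \<in> ?B" using h pos by (auto simp: Suc_le_eq)
    qed
  qed auto
  also have "\<dots> = (\<Sum>s\<in>{1..H}. \<Sum>u\<in>{1..H div s\<^sup>2}. 1 / sqrt (real u))"
    by (rule sum.Sigma [symmetric]) auto
  also have "\<dots> \<le> (\<Sum>s\<in>{1..H}. 2 * sqrt (real H) * inverse (real s))"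
  proof (rule sum_mono)
    fix s assume s: "s \<in> {1..H}"
    have "(\<Sum>u\<in>{1..H div s\<^sup>2}. 1 / sqrt (real u)) \<le> 2 * sqrt (real (H div s\<^sup>2))"
      by (rule sum_inverse_sqrt_le)
    also have "\<dots> \<le> 2 * sqrt (real H / (real s)\<^sup>2)"
      using of_nat_div_le_of_nat[of H "s\<^sup>2", where ?'a = real] by simp
    also have "\<dots> = 2 * sqrt (real H) * inverse (real s)"
      by (simp add: real_sqrt_divide) (simp add: divide_inverse)
    finally show "(\<Sum>u\<in>{1..H div s\<^sup>2}. 1 / sqrt (real u)) \<le> 2 * sqrt (real H) * inverse (real s)" .
  qed
  finally show ?thesis by (simp add: harm_def sum_distrib_left)
qed

text \<open>The pairs are sorted by \<open>d = gcd u m\<close>: then \<open>u\<close> is a multiple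
  of \<open>d\<close> and \<open>v\<close> one of \<open>m div d\<close>, which allows at most
  \<open>(m div d) * d = m\<close> pairs for each divisor.\<close>

lemma card_product_zero_le:
  fixes m :: nat
  assumes "m > 0"
  shows "card {(u, v). u < m \<and> v < m \<and> m dvd u * v} \<le> m * card {d. d dvd m}"
proof -
  have fin: "finite {d. d dvd m}" using assms by simp
  let ?S = "\<lambda>d. (\<lambda>k. d * k) ` {..<m div d} \<times> (\<lambda>k. (m div d) * k) ` {..<d}"
  have "{(u, v). u < m \<and> v < m \<and> m dvd u * v} \<subseteq> (\<Union>d\<in>{d. d dvd m}. ?S d)"
  proof clarify
    fix u v assume uv: "u < m" "v < m" "m dvd u * v"
    define d where "d = gcd u m"
    have "gcd u m \<noteq> 0" using assms by simp
    from gcd_coprime_exists[OF this] obtain k l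
      where kl: "u = k * gcd u m" "m = l * gcd u m" "coprime k l" by blast
    have u: "u = d * k" and m: "m = d * l"
      using kl(1,2) unfolding d_def by (metis mult.commute)+
    have d: "d > 0" "d dvd m" using assms by (auto simp: d_def)
    have "l dvd k * v" using uv(3) d(1) unfolding u m by (simp add: mult.assoc)
    then have "l dvd v" using kl(3) by (simp add: coprime_dvd_mult_right_iff coprime_commute)
    then obtain j where v: "v = l * j" by auto
    have l: "m div d = l" using m d by simp
    have "k < l" using uv(1) d(1) unfolding u m by simp
    moreover have "j < d" using uv(2) unfolding v m by (simp add: mult.commute)
    ultimately have "(u, v) \<in> ?S d" unfolding l u v by auto
    then show "(u, v) \<in> (\<Union>d\<in>{d. d dvd m}. ?S d)" using d by blast
  qed
  then have "card {(u, v). u < m \<and> v < m \<and> m dvd u * v} \<le> card (\<Union>d\<in>{d. d dvd m}. ?S d)"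
    using fin by (intro card_mono) auto
  also have "\<dots> \<le> (\<Sum>d\<in>{d. d dvd m}. card (?S d))"
    by (rule card_UN_le[OF fin])
  also have "\<dots> \<le> (\<Sum>d\<in>{d. d dvd m}. m)"
  proof (rule sum_mono)
    fix d assume "d \<in> {d. d dvd m}"
    have "card (?S d) \<le> (m div d) * d"
      unfolding card_cartesian_product
      by (intro mult_le_mono order_trans[OF card_image_le]) auto
    then show "card (?S d) \<le> m" using \<open>d \<in> {d. d dvd m}\<close> by simp
  qed
  finally show ?thesis by (simp add: mult.commute)
qed

text \<open>For \<open>b \<le> a\<close> the pair \<open>(a - b, a + b)\<close> determines
  \<open>(a, b)\<close>, has product divisible by \<open>4 * h\<close>, and has entries below
  \<open>4 * h\<close>. The other order is its mirror image and doubles the bound.\<close>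

lemma card_equal_squares_le:
  fixes h :: nat
  assumes "h > 0"
  shows "card {(a, b). a < 2 * h \<and> b < 2 * h \<and> 4 * int h dvd (int a)\<^sup>2 - (int b)\<^sup>2} \<le> 8 * h * card {d. d dvd 4 * h}"
proof -
  let ?P = "{(a, b). b \<le> a \<and> a < 2 * h \<and> 4 * int h dvd (int a)\<^sup>2 - (int b)\<^sup>2}"
  let ?Z = "{(u, v). u < 4 * h \<and> v < 4 * h \<and> 4 * h dvd u * v}"
  have finZ: "finite ?Z"
    by (rule finite_subset[of _ "{..<4 * h} \<times> {..<4 * h}"]) auto
  have finP: "finite ?P"
    by (rule finite_subset[of _ "{..<2 * h} \<times> {..<2 * h}"]) auto
  have "card ?P \<le> card ?Z"
  proof (rule card_inj_on_le[OF _ _ finZ])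
    show "inj_on (\<lambda>(a, b). (a - b, a + b)) ?P"
      by (rule inj_onI) auto
    show "(\<lambda>(a, b). (a - b, a + b)) ` ?P \<subseteq> ?Z"
    proof clarify
      fix a b assume ab: "b \<le> a" "a < 2 * h" "4 * int h dvd (int a)\<^sup>2 - (int b)\<^sup>2"
      have "(int a)\<^sup>2 - (int b)\<^sup>2 = int ((a - b) * (a + b))"
        unfolding of_nat_mult of_nat_diff[OF ab(1)] of_nat_add by (simp add: power2_eq_square algebra_simps)
      with ab(3) have "int (4 * h) dvd int ((a - b) * (a + b))" by simp
      then have "4 * h dvd (a - b) * (a + b)" by (simp only: of_nat_dvd_iff)
      then show "a - b < 4 * h \<and> a + b < 4 * h \<and> 4 * h dvd (a - b) * (a + b)"
        using ab by auto
    qed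
  qed
  also have "\<dots> \<le> 4 * h * card {d. d dvd 4 * h}"
    using assms by (intro card_product_zero_le) simp
  finally have P: "card ?P \<le> 4 * h * card {d. d dvd 4 * h}" .
  have "{(a, b). a < 2 * h \<and> b < 2 * h \<and> 4 * int h dvd (int a)\<^sup>2 - (int b)\<^sup>2} \<subseteq> ?P \<union> prod.swap ` ?P"
  proof clarify
    fix a b assume ab: "a < 2 * h" "b < 2 * h" "4 * int h dvd (int a)\<^sup>2 - (int b)\<^sup>2" "(a, b) \<notin> prod.swap ` ?P"
    have "4 * int h dvd (int b)\<^sup>2 - (int a)\<^sup>2"
      using ab(3) by (rule dvd_diff_commute [THEN iffD1])
    moreover have "(a, b) = prod.swap (b, a)" by simp
    ultimately have "\<not> a \<le> b" using ab(2,4) by blast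
    then show "b \<le> a \<and> a < 2 * h \<and> 4 * int h dvd (int a)\<^sup>2 - (int b)\<^sup>2" using ab by simp
  qed
  then have "card {(a, b). a < 2 * h \<and> b < 2 * h \<and> 4 * int h dvd (int a)\<^sup>2 - (int b)\<^sup>2} \<le> card (?P \<union> prod.swap ` ?P)"
    using finP by (intro card_mono) auto
  also have "\<dots> \<le> card ?P + card (prod.swap ` ?P)" by (rule card_Un_le)
  also have "\<dots> \<le> card ?P + card ?P" using card_image_le[OF finP] by simp
  finally show ?thesis using P by simp
qed

text \<open>The values \<open>4 * h\<close> are distinct and at most \<open>4 * H\<close>, so all
  integers up to there may be included; counting multiples of each \<open>d\<close> then gives the
  divisor problem bound.\<close>

lemma sum_card_divisors_le:
  "(\<Sum>h\<in>{1..<H}. real (card {d. d dvd 4 * h})) \<le> 4 * real H * harm (4 * H)"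
proof -
  let ?N = "4 * H"
  have "(\<Sum>h\<in>{1..<H}. real (card {d. d dvd 4 * h})) = (\<Sum>m\<in>(\<lambda>h. 4 * h) ` {1..<H}. real (card {d. d dvd m}))"
    by (subst sum.reindex) (auto simp: inj_on_def)
  also have "\<dots> \<le> (\<Sum>m\<in>{1..?N}. real (card {d. d dvd m}))"
    by (intro sum_mono2) auto
  also have "\<dots> = (\<Sum>m\<in>{1..?N}. \<Sum>d\<in>{1..?N}. of_bool (d dvd m))"
  proof (rule sum.cong)
    fix m assume m: "m \<in> {1..?N}"
    have "{d. d dvd m} \<subseteq> {1..?N}"
    proof
      fix d assume "d \<in> {d. d dvd m}"
      then have d: "d dvd m" by simp
      have "m > 0" using m by simp
      then have "d > 0" "d \<le> m" using dvd_pos_nat[OF _ d] dvd_imp_le[OF d] by blast+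
      then show "d \<in> {1..?N}" using m by simp
    qed
    then have "{1..?N} \<inter> {d. d dvd m} = {d. d dvd m}" by blast
    moreover have "(\<Sum>d\<in>{1..?N}. of_bool (d dvd m)) = real (card ({1..?N} \<inter> {d. d dvd m}))"
      by simp
    ultimately show "real (card {d. d dvd m}) = (\<Sum>d\<in>{1..?N}. of_bool (d dvd m))"
      by (simp only:)
  qed (rule refl)
  also have "\<dots> = (\<Sum>d\<in>{1..?N}. real (card {m \<in> {1..?N}. d dvd m}))"
  proof (subst sum.swap, rule sum.cong)
    fix d
    have "(\<Sum>m\<in>{1..?N}. of_bool (d dvd m)) = real (card ({1..?N} \<inter> {m. d dvd m}))"
      by simp
    also have "{1..?N} \<inter> {m. d dvd m} = {m \<in> {1..?N}. d dvd m}" by blast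
    finally show "(\<Sum>m\<in>{1..?N}. of_bool (d dvd m)) = real (card {m \<in> {1..?N}. d dvd m})" .
  qed (rule refl)
  also have "\<dots> \<le> (\<Sum>d\<in>{1..?N}. real ?N * inverse (real d))"
    unfolding divide_inverse [symmetric] by (intro sum_mono card_multiples_le) auto
  finally show ?thesis by (simp add: harm_def sum_distrib_left)
qed

subsection \<open>The mean square of the dual sum\<close>

definition dual_index :: "nat \<Rightarrow> (nat \<times> nat) set" where
  "dual_index H = Sigma {1..<H} (\<lambda>h. {..<2 * h})"

definition dual_weight :: "nat \<Rightarrow> nat \<Rightarrow> real" where
  "dual_weight H h = (real H - real h) / ((real H)\<^sup>2 * sqrt (real h))"

text \<open>Only the class modulo 1 matters because \<open>q\<close> is an integer;
  \<open>frac\<close> picks the representative, so that coinciding frequencies are equal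
  reals.\<close>

definition dual_freq :: "nat \<times> nat \<Rightarrow> real" where
  "dual_freq i = frac ((real (snd i))\<^sup>2 / (4 * real (fst i)))"

text \<open>The large sieve requires distinct frequencies, so pairs with a common one are merged;
  the squares of these coefficients measure the collisions.\<close>

definition dual_coeff :: "nat \<Rightarrow> real \<Rightarrow> real" where
  "dual_coeff H \<beta> = (\<Sum>i\<in>{i \<in> dual_index H. dual_freq i = \<beta>}. dual_weight H (fst i))"

lemma finite_dual_index [simp]: "finite (dual_index H)"
  by (simp add: dual_index_def)

lemma dual_weight_nonneg: "h \<le> H \<Longrightarrow> 0 \<le> dual_weight H h"
  by (simp add: dual_weight_def)

lemma dual_weight_le:
  assumes "h \<le> H"
  shows "dual_weight H h \<le> 1 / (real H * sqrt (real h))"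
proof -
  have "dual_weight H h = (real H - real h) / (real H)\<^sup>2 * (1 / sqrt (real h))"
    by (simp add: dual_weight_def)
  also have "\<dots> \<le> real H / (real H)\<^sup>2 * (1 / sqrt (real h))"
    using assms by (intro mult_right_mono divide_right_mono) auto
  also have "\<dots> = 1 / (real H * sqrt (real h))"
    by (simp add: power2_eq_square)
  finally show ?thesis .
qed

lemma dual_sum_eq:
  "dual_sum H q = (\<Sum>\<beta>\<in>dual_freq ` dual_index H. of_real (dual_coeff H \<beta>) * cis (- (2 * pi * (\<beta> * real q))))"
proof -
  have per: "cis (- (2 * pi * ((real n)\<^sup>2 * real q / (4 * real h)))) = cis (- (2 * pi * (dual_freq (h, n) * real q)))" for h n
  proof -
    let ?x = "(real n)\<^sup>2 / (4 * real h)"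
    have "?x = dual_freq (h, n) + of_int \<lfloor>?x\<rfloor>" by (simp add: dual_freq_def frac_def)
    then have "(real n)\<^sup>2 * real q / (4 * real h) = (dual_freq (h, n) + of_int \<lfloor>?x\<rfloor>) * real q"
      by (metis times_divide_eq_left)
    then have "- (2 * pi * ((real n)\<^sup>2 * real q / (4 * real h)))
       = - (2 * pi * (dual_freq (h, n) * real q)) + 2 * pi * of_int (- (\<lfloor>?x\<rfloor> * int q))"
      by (simp add: algebra_simps)
    also have "cis \<dots> = cis (- (2 * pi * (dual_freq (h, n) * real q))) * cis (2 * pi * of_int (- (\<lfloor>?x\<rfloor> * int q)))"
      by (rule cis_mult [symmetric])
    also have "cis (2 * pi * of_int (- (\<lfloor>?x\<rfloor> * int q))) = 1"
      by (rule cis_multiple_2pi) simp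
    finally show ?thesis by simp
  qed
  have "dual_sum H q = (\<Sum>h\<in>{1..<H}. \<Sum>n<2*h. of_real (dual_weight H h) * cis (- (2 * pi * (dual_freq (h, n) * real q))))"
    unfolding dual_sum_def dual_weight_def per ..
  also have "\<dots> = (\<Sum>i\<in>dual_index H. of_real (dual_weight H (fst i)) * cis (- (2 * pi * (dual_freq i * real q))))"
    unfolding dual_index_def by (subst sum.Sigma) (auto simp: case_prod_unfold)
  also have "\<dots> = (\<Sum>\<beta>\<in>dual_freq ` dual_index H. \<Sum>i\<in>{i \<in> dual_index H. dual_freq i = \<beta>}.
      of_real (dual_weight H (fst i)) * cis (- (2 * pi * (dual_freq i * real q))))"
    by (rule sum.group [symmetric]) auto
  also have "\<dots> = (\<Sum>\<beta>\<in>dual_freq ` dual_index H. of_real (dual_coeff H \<beta>) * cis (- (2 * pi * (\<beta> * real q))))"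
    unfolding dual_coeff_def of_real_sum sum_distrib_right by (intro sum.cong) auto
  finally show ?thesis .
qed

lemma frac_of_nat_divide:
  fixes a m :: nat
  assumes "m > 0"
  shows "frac (real a / real m) = real (a mod m) / real m"
proof -
  have "real a = real (a div m) * real m + real (a mod m)"
    by (metis div_mult_mod_eq of_nat_add of_nat_mult)
  then have "real a / real m - real (a mod m) / real m = real (a div m)"
    using assms by (simp add: field_simps)
  then have "real a / real m - real (a mod m) / real m \<in> \<int>"
    by simp
  then show ?thesis
    using assms unfolding frac_unique_iff by simp
qed

text \<open>Fractions with denominators \<open>4 * h\<close> and \<open>4 * h'\<close> share the
  denominator \<open>4 * h * h'\<close>, not just \<open>16 * h * h'\<close>. A nonzero difference
  of representatives in \<open>[0, 1)\<close> thus stays \<open>1 / (4 * h * h')\<close> away from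
  both 0 and 1 in absolute value.\<close>

lemma dual_freq_separated:
  assumes "\<beta> \<in> dual_freq ` dual_index H" "\<gamma> \<in> dual_freq ` dual_index H" "\<beta> \<noteq> \<gamma>"
  shows "1 / real (4 * H\<^sup>2) \<le> \<bar>\<beta> - \<gamma>\<bar> \<and> \<bar>\<beta> - \<gamma>\<bar> \<le> 1 - 1 / real (4 * H\<^sup>2)"
proof -
  have rep: "\<exists>h b. 1 \<le> h \<and> h < H \<and> \<beta> = real b / (4 * real h) \<and> b < 4 * h" if "\<beta> \<in> dual_freq ` dual_index H" for \<beta>
  proof -
    from that obtain h n where i: "(h, n) \<in> dual_index H" "\<beta> = dual_freq (h, n)" by auto
    then have h: "1 \<le> h" "h < H" by (auto simp: dual_index_def)
    then have "\<beta> = real (n\<^sup>2 mod (4 * h)) / (4 * real h)"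
      using i frac_of_nat_divide[of "4 * h" "n\<^sup>2"] by (simp add: dual_freq_def)
    moreover have "n\<^sup>2 mod (4 * h) < 4 * h" using h by simp
    ultimately show ?thesis using h by blast
  qed
  obtain h b h' b' where 1: "1 \<le> h" "h < H" "\<beta> = real b / (4 * real h)" "b < 4 * h"
    and 2: "1 \<le> h'" "h' < H" "\<gamma> = real b' / (4 * real h')" "b' < 4 * h'"
    using rep[OF assms(1)] rep[OF assms(2)] by blast
  define N where "N = int b * int h' - int b' * int h"
  define m where "m = 4 * int h * int h'"
  have m: "m > 0" using 1 2 by (simp add: m_def)
  have diff: "\<beta> - \<gamma> = of_int N / of_int m"
    unfolding 1(3) 2(3) N_def m_def using 1(1) 2(1) by (simp add: field_simps)
  have "N \<noteq> 0" using diff assms(3) by auto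
  moreover have "\<bar>N\<bar> < m"
  proof -
    have "0 \<le> \<beta>" "\<beta> < 1" "0 \<le> \<gamma>" "\<gamma> < 1" using 1 2 by auto
    then have "\<bar>\<beta> - \<gamma>\<bar> < 1" by linarith
    then have "\<bar>of_int N / of_int m :: real\<bar> < 1" by (simp only: diff)
    then have "\<bar>of_int N :: real\<bar> < of_int m" using m by (simp add: abs_divide)
    then show ?thesis by (simp flip: of_int_abs)
  qed
  ultimately have N: "1 \<le> \<bar>N\<bar>" "\<bar>N\<bar> \<le> m - 1" by linarith+
  have "m \<le> int (4 * H\<^sup>2)"
    using 1 2 by (simp add: m_def power2_eq_square mult_mono)
  then have "real_of_int m \<le> real_of_int (int (4 * H\<^sup>2))"
    by (simp only: of_int_le_iff)
  then have "real_of_int m \<le> real (4 * H\<^sup>2)"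
    by (simp only: of_int_of_nat_eq)
  then have "1 / real (4 * H\<^sup>2) \<le> 1 / of_int m"
    using m by (intro frac_le) auto
  moreover have "1 / of_int m \<le> \<bar>\<beta> - \<gamma>\<bar>"
  proof -
    have "(1::real) \<le> of_int \<bar>N\<bar>" using N(1) by linarith
    then have "1 / of_int m \<le> real_of_int \<bar>N\<bar> / of_int m" using m by (intro divide_right_mono) auto
    then show ?thesis using m by (simp add: diff abs_divide)
  qed
  moreover have "\<bar>\<beta> - \<gamma>\<bar> \<le> 1 - 1 / of_int m"
  proof -
    have "real_of_int \<bar>N\<bar> \<le> of_int m - 1" using N(2) by linarith
    then have "real_of_int \<bar>N\<bar> / of_int m \<le> (of_int m - 1) / of_int m" using m by (intro divide_right_mono) auto
    then show ?thesis using m by (simp add: diff abs_divide diff_divide_distrib)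
  qed
  ultimately show ?thesis by linarith
qed

lemma dual_freq_multiple_Int_iff:
  assumes "h \<ge> 1"
  shows "real r * dual_freq (h, n) \<in> \<int> \<longleftrightarrow> 4 * h dvd r * n\<^sup>2"
proof -
  let ?x = "(real n)\<^sup>2 / (4 * real h)"
  have "real r * dual_freq (h, n) = real r * ?x - of_int (int r * \<lfloor>?x\<rfloor>)"
    by (simp add: dual_freq_def frac_def right_diff_distrib)
  then have "real r * dual_freq (h, n) \<in> \<int> \<longleftrightarrow> real r * ?x \<in> \<int>"
    by (metis Ints_diff Ints_add Ints_of_int diff_add_cancel)
  also have "real r * ?x = of_int (int (r * n\<^sup>2)) / of_int (int (4 * h))"
    by simp
  also have "\<dots> \<in> \<int> \<longleftrightarrow> int (4 * h) dvd int (r * n\<^sup>2)"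
    unfolding of_int_div_of_int_in_Ints_iff using assms by simp
  also have "\<dots> \<longleftrightarrow> 4 * h dvd r * n\<^sup>2"
    by (simp only: of_nat_dvd_iff)
  finally show ?thesis .
qed

lemma dual_freq_eq_imp_dvd:
  assumes "h \<ge> 1" "dual_freq (h, a) = dual_freq (h, b)"
  shows "4 * int h dvd (int a)\<^sup>2 - (int b)\<^sup>2"
proof -
  have "(a\<^sup>2) mod (4 * h) = (b\<^sup>2) mod (4 * h)"
    using frac_of_nat_divide[of "4 * h" "a\<^sup>2"] frac_of_nat_divide[of "4 * h" "b\<^sup>2"] assms
    by (auto simp: dual_freq_def)
  then have "int (a\<^sup>2) mod int (4 * h) = int (b\<^sup>2) mod int (4 * h)"
    by (metis of_nat_mod)
  then show ?thesis by (simp add: mod_eq_dvd_iff)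
qed

text \<open>In other words, \<beta> is rational with reduced denominator at most \<open>R\<close>.
  Such frequencies can occur for many \<open>h\<close> at once, and there are few of them.\<close>

definition low_denominator :: "nat \<Rightarrow> real \<Rightarrow> bool" where
  "low_denominator R \<beta> \<longleftrightarrow> (\<exists>r\<in>{1..R}. real r * \<beta> \<in> \<int>)"

lemma sum_of_bool_times:
  fixes c :: real and N :: nat
  shows "(\<Sum>n<N. of_bool (P n) * c) = real (card {n. n < N \<and> P n}) * c"
proof -
  have "(\<Sum>n<N. of_bool (P n)) = real (card ({..<N} \<inter> {n. P n}))"
    by simp
  also have "{..<N} \<inter> {n. P n} = {n. n < N \<and> P n}" by auto
  finally have "(\<Sum>n<N. of_bool (P n)) = real (card {n. n < N \<and> P n})" .
  then show ?thesis by (simp only: sum_distrib_right [symmetric])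
qed

text \<open>Here even the total weight is small. A contributing pair satisfies
  \<open>4 * h dvd r * n^2\<close> for some \<open>r \<le> R\<close>, and few \<open>n\<close> do so
  unless \<open>h\<close> has a large square part. One factor \<open>R\<close> comes from the number
  of \<open>r\<close>, the other from the bound for each \<open>r\<close>.\<close>

lemma sum_dual_coeff_low_denominator_le:
  "(\<Sum>\<beta>\<in>{\<beta> \<in> dual_freq ` dual_index H. low_denominator R \<beta>}. dual_coeff H \<beta>)
     \<le> 4 * (real R)\<^sup>2 * harm H / sqrt (real H)"
proof (cases "H = 0")
  case False
  let ?A = "{\<beta> \<in> dual_freq ` dual_index H. low_denominator R \<beta>}"
  let ?I = "{i \<in> dual_index H. low_denominator R (dual_freq i)}"
  have "(\<Sum>\<beta>\<in>?A. dual_coeff H \<beta>) = (\<Sum>\<beta>\<in>?A. \<Sum>i\<in>{i \<in> ?I. dual_freq i = \<beta>}. dual_weight H (fst i))"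
    unfolding dual_coeff_def by (intro sum.cong) auto
  also have "\<dots> = (\<Sum>i\<in>?I. dual_weight H (fst i))"
    by (rule sum.group) auto
  also have "\<dots> \<le> (\<Sum>i\<in>dual_index H. \<Sum>r\<in>{1..R}. of_bool (fst i dvd r * (snd i)\<^sup>2) * (1 / (real H * sqrt (real (fst i)))))"
  proof (rule order_trans)
    show "(\<Sum>i\<in>?I. dual_weight H (fst i)) \<le> (\<Sum>i\<in>?I. \<Sum>r\<in>{1..R}. of_bool (fst i dvd r * (snd i)\<^sup>2) * (1 / (real H * sqrt (real (fst i)))))"
    proof (rule sum_mono)
      fix i assume "i \<in> ?I"
      then obtain h n r where i: "i = (h, n)" "1 \<le> h" "h < H" "r \<in> {1..R}" "real r * dual_freq (h, n) \<in> \<int>"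
        by (cases i) (auto simp: dual_index_def low_denominator_def)
      then have "4 * h dvd r * n\<^sup>2" using dual_freq_multiple_Int_iff by blast
      \<comment> \<open>Dropping the factor 4 loses only a constant and fits the square
        decomposition of \<open>h\<close>.\<close>
      then have "h dvd r * n\<^sup>2" by (rule dvd_mult_right)
      then have "dual_weight H (fst i) \<le> of_bool (fst i dvd r * (snd i)\<^sup>2) * (1 / (real H * sqrt (real (fst i))))"
        using dual_weight_le[of h H] i by simp
      also have "\<dots> \<le> (\<Sum>r\<in>{1..R}. of_bool (fst i dvd r * (snd i)\<^sup>2) * (1 / (real H * sqrt (real (fst i)))))"
        using i(4) by (rule member_le_sum) auto
      finally show "dual_weight H (fst i) \<le> \<dots>" .
    qed
    show "(\<Sum>i\<in>?I. \<Sum>r\<in>{1..R}. of_bool (fst i dvd r * (snd i)\<^sup>2) * (1 / (real H * sqrt (real (fst i)))))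
       \<le> (\<Sum>i\<in>dual_index H. \<Sum>r\<in>{1..R}. of_bool (fst i dvd r * (snd i)\<^sup>2) * (1 / (real H * sqrt (real (fst i)))))"
      by (intro sum_mono2) (auto intro!: sum_nonneg)
  qed
  also have "\<dots> = (\<Sum>r\<in>{1..R}. \<Sum>h\<in>{1..<H}. \<Sum>n<2*h. of_bool (h dvd r * n\<^sup>2) * (1 / (real H * sqrt (real h))))"
    unfolding dual_index_def by (subst sum.swap) (simp add: sum.Sigma case_prod_unfold)
  also have "\<dots> = (\<Sum>r\<in>{1..R}. \<Sum>h\<in>{1..<H}. real (card {n. n < 2 * h \<and> h dvd r * n\<^sup>2}) * (1 / (real H * sqrt (real h))))"
    by (simp only: sum_of_bool_times)
  also have "\<dots> \<le> (\<Sum>r\<in>{1..R}. \<Sum>h\<in>{1..<H}. 2 * real R / real H * (real (square_part h) / sqrt (real h)))"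
  proof (intro sum_mono)
    fix r h assume rh: "r \<in> {1..R}" "h \<in> {1..<H}"
    then have "card {n. n < 2 * h \<and> h dvd r * n\<^sup>2} \<le> 2 * r * square_part h"
      by (intro card_quadratic_congruence_zero_le) auto
    also have "\<dots> \<le> 2 * R * square_part h" using rh by simp
    finally have "real (card {n. n < 2 * h \<and> h dvd r * n\<^sup>2}) \<le> real (2 * R * square_part h)"
      by (simp only: of_nat_le_iff)
    then have "real (card {n. n < 2 * h \<and> h dvd r * n\<^sup>2}) * (1 / (real H * sqrt (real h)))
        \<le> real (2 * R * square_part h) * (1 / (real H * sqrt (real h)))"
      by (intro mult_right_mono) auto
    then show "real (card {n. n < 2 * h \<and> h dvd r * n\<^sup>2}) * (1 / (real H * sqrt (real h)))
        \<le> 2 * real R / real H * (real (square_part h) / sqrt (real h))"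
      by (simp add: mult_ac)
  qed
  also have "\<dots> = real R * (2 * real R / real H * (\<Sum>h\<in>{1..<H}. real (square_part h) / sqrt (real h)))"
    by (simp add: sum_distrib_left)
  also have "\<dots> \<le> real R * (2 * real R / real H * (2 * sqrt (real H) * harm H))"
    by (intro mult_left_mono sum_square_part_le) auto
  also have "\<dots> = 4 * (real R)\<^sup>2 * harm H * (sqrt (real H) / real H)"
    by (simp add: power2_eq_square mult_ac)
  also have "sqrt (real H) / real H = 1 / sqrt (real H)"
    using False by (simp add: field_simps)
  finally show ?thesis by simp
qed (simp add: dual_index_def)

text \<open>
  If \<open>\<beta>\<close> has no small denominator, then few \<open>h\<close> contribute to the coefficient at \<open>\<beta>\<close>, and
  Cauchy-Schwarz over these \<open>h\<close> leaves the diagonal count of \<open>a\<^sup>2 \<equiv> b\<^sup>2\<close> modulo \<open>4 h\<close>.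
\<close>

lemma card_contributing_le:
  assumes "\<not> low_denominator R \<beta>" "R > 0"
  shows "real (card {h \<in> {1..<H}. \<exists>n. dual_freq (h, n) = \<beta>}) \<le> 4 * real H / real R"
proof (cases "{h \<in> {1..<H}. \<exists>n. dual_freq (h, n) = \<beta>} = {}")
  case False
  have int: "real (4 * h) * \<beta> \<in> \<int>" if "1 \<le> h" "dual_freq (h, n) = \<beta>" for h n
    using dual_freq_multiple_Int_iff[OF that(1), of "4 * h" n] that(2) by simp
  \<comment> \<open>Every contributing \<open>h\<close> satisfies \<open>P\<close>, and the
    solutions of \<open>P\<close> are the multiples of the least one, \<open>t\<close>. Since
    \<open>4 * t\<close> is itself a denominator of \<beta>, it must exceed \<open>R\<close>, so the
    contributing \<open>h\<close> are sparse.\<close>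
  define P where "P = (\<lambda>t::nat. t \<ge> 1 \<and> real (4 * t) * \<beta> \<in> \<int>)"
  define t where "t = (LEAST t. P t)"
  have "\<exists>t. P t" using False int by (auto simp: P_def)
  then have t: "P t" and least: "\<And>s. P s \<Longrightarrow> t \<le> s"
    unfolding t_def by (auto intro: LeastI_ex Least_le)
  have tR: "R < 4 * t"
  proof (rule ccontr)
    assume "\<not> R < 4 * t"
    then have "low_denominator R \<beta>" using t unfolding low_denominator_def P_def by (intro bexI[of _ "4 * t"]) auto
    then show False using assms(1) by simp
  qed
  have dvd: "t dvd h" if "P h" for h
  proof (rule ccontr)
    assume "\<not> t dvd h"
    then have "h mod t \<noteq> 0" by (simp add: dvd_eq_mod_eq_0)
    have "real (4 * (h mod t)) * \<beta> = real (4 * h) * \<beta> - real (h div t) * (real (4 * t) * \<beta>)"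
    proof -
      have "real h = real (h div t) * real t + real (h mod t)"
        by (metis div_mult_mod_eq of_nat_add of_nat_mult)
      then show ?thesis by (simp add: algebra_simps)
    qed
    also have "\<dots> \<in> \<int>"
      by (rule Ints_diff[OF _ Ints_mult[OF Ints_of_nat]]) (use t that in \<open>auto simp: P_def\<close>)
    finally have "P (h mod t)" using \<open>h mod t \<noteq> 0\<close> by (simp add: P_def)
    then have "t \<le> h mod t" by (rule least)
    moreover have "h mod t < t" using t by (simp add: P_def)
    ultimately show False by simp
  qed
  have "{h \<in> {1..<H}. \<exists>n. dual_freq (h, n) = \<beta>} \<subseteq> {h \<in> {1..H}. t dvd h}"
    using int dvd by (auto simp: P_def)
  then have "real (card {h \<in> {1..<H}. \<exists>n. dual_freq (h, n) = \<beta>}) \<le> real (card {h \<in> {1..H}. t dvd h})"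
    by (intro of_nat_mono card_mono) auto
  also have "\<dots> \<le> real H / real t"
    using t by (intro card_multiples_le) (simp add: P_def)
  also have "\<dots> = 4 * real H / real (4 * t)" by simp
  also have "\<dots> \<le> 4 * real H / real R"
    using tR assms(2) by (intro divide_left_mono) auto
  finally show ?thesis .
next
  case True
  show ?thesis unfolding True by simp
qed

lemma sum_dual_coeff_squares_high_denominator_le:
  assumes R: "R > 0"
  shows "(\<Sum>\<beta>\<in>{\<beta> \<in> dual_freq ` dual_index H. \<not> low_denominator R \<beta>}. (dual_coeff H \<beta>)\<^sup>2)
     \<le> 128 * harm (4 * H) / real R"
proof (cases "H = 0")
  case False
  let ?A = "{\<beta> \<in> dual_freq ` dual_index H. \<not> low_denominator R \<beta>}"
  define \<rho> where "\<rho> = (\<lambda>h \<beta>. card {n. n < 2 * h \<and> dual_freq (h, n) = \<beta>})"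
  have coeff: "dual_coeff H \<beta> = (\<Sum>h\<in>{h \<in> {1..<H}. \<exists>n. dual_freq (h, n) = \<beta>}. real (\<rho> h \<beta>) * dual_weight H h)" for \<beta>
  proof -
    have "{i \<in> dual_index H. dual_freq i = \<beta>} = Sigma {1..<H} (\<lambda>h. {n. n < 2 * h \<and> dual_freq (h, n) = \<beta>})"
      by (auto simp: dual_index_def)
    then have "dual_coeff H \<beta> = (\<Sum>h\<in>{1..<H}. \<Sum>n\<in>{n. n < 2 * h \<and> dual_freq (h, n) = \<beta>}. dual_weight H h)"
      unfolding dual_coeff_def by (subst sum.Sigma) (auto simp: case_prod_unfold)
    also have "\<dots> = (\<Sum>h\<in>{1..<H}. real (\<rho> h \<beta>) * dual_weight H h)"
      by (simp add: \<rho>_def)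
    also have "\<dots> = (\<Sum>h\<in>{h \<in> {1..<H}. \<exists>n. dual_freq (h, n) = \<beta>}. real (\<rho> h \<beta>) * dual_weight H h)"
      by (rule sum.mono_neutral_right) (auto simp: \<rho>_def)
    finally show ?thesis .
  qed
  have "(\<Sum>\<beta>\<in>?A. (dual_coeff H \<beta>)\<^sup>2) \<le> (\<Sum>\<beta>\<in>?A. 4 * real H / real R * (\<Sum>h\<in>{1..<H}. (real (\<rho> h \<beta>) * dual_weight H h)\<^sup>2))"
  proof (rule sum_mono)
    fix \<beta> assume "\<beta> \<in> ?A"
    let ?S = "{h \<in> {1..<H}. \<exists>n. dual_freq (h, n) = \<beta>}"
    have "(dual_coeff H \<beta>)\<^sup>2 \<le> (\<Sum>h\<in>?S. (real (\<rho> h \<beta>) * dual_weight H h)\<^sup>2) * real (card ?S)"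
      unfolding coeff by (rule sum_squared_le_sum_of_squares)
    also have "\<dots> \<le> (\<Sum>h\<in>{1..<H}. (real (\<rho> h \<beta>) * dual_weight H h)\<^sup>2) * (4 * real H / real R)"
      using \<open>\<beta> \<in> ?A\<close> R by (intro mult_mono card_contributing_le sum_mono2 sum_nonneg) auto
    finally show "(dual_coeff H \<beta>)\<^sup>2 \<le> 4 * real H / real R * (\<Sum>h\<in>{1..<H}. (real (\<rho> h \<beta>) * dual_weight H h)\<^sup>2)"
      by (simp only: mult.commute)
  qed
  also have "\<dots> = 4 * real H / real R * (\<Sum>h\<in>{1..<H}. (dual_weight H h)\<^sup>2 * (\<Sum>\<beta>\<in>?A. (real (\<rho> h \<beta>))\<^sup>2))"
  proof -
    have "(\<Sum>\<beta>\<in>?A. \<Sum>h\<in>{1..<H}. (real (\<rho> h \<beta>) * dual_weight H h)\<^sup>2) = (\<Sum>h\<in>{1..<H}. (dual_weight H h)\<^sup>2 * (\<Sum>\<beta>\<in>?A. (real (\<rho> h \<beta>))\<^sup>2))"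
      by (subst sum.swap) (simp add: sum_distrib_left power_mult_distrib mult.commute)
    then show ?thesis by (simp only: sum_distrib_left [symmetric])
  qed
  also have "\<dots> \<le> 4 * real H / real R * (\<Sum>h\<in>{1..<H}. 8 / (real H)\<^sup>2 * real (card {d. d dvd 4 * h}))"
  proof (intro mult_left_mono sum_mono)
    fix h assume h: "h \<in> {1..<H}"
    let ?E = "{(a, b). a < 2 * h \<and> b < 2 * h \<and> 4 * int h dvd (int a)\<^sup>2 - (int b)\<^sup>2}"
    let ?F = "\<lambda>\<beta>. {n. n < 2 * h \<and> dual_freq (h, n) = \<beta>}"
    have finE: "finite ?E"
      by (rule finite_subset[of _ "{..<2 * h} \<times> {..<2 * h}"]) auto
    have finA: "finite ?A" by simp
    \<comment> \<open>For fixed \<open>h\<close>, the squared multiplicities count pairs with equal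
      frequency; the squares \<open>?F \<beta> \<times> ?F \<beta>\<close> are disjoint, so they can
      be counted together.\<close>
    have "(\<Sum>\<beta>\<in>?A. (\<rho> h \<beta>)\<^sup>2) = (\<Sum>\<beta>\<in>?A. card (?F \<beta> \<times> ?F \<beta>))"
      by (simp add: \<rho>_def card_cartesian_product power2_eq_square)
    also have "\<dots> = card (\<Union>\<beta>\<in>?A. ?F \<beta> \<times> ?F \<beta>)"
      using finA by (intro card_UN_disjoint [symmetric]) auto
    also have "\<dots> \<le> card ?E"
    proof (rule card_mono[OF finE])
      show "(\<Union>\<beta>\<in>?A. ?F \<beta> \<times> ?F \<beta>) \<subseteq> ?E"
        using h dual_freq_eq_imp_dvd[of h] by force
    qed
    also have "\<dots> \<le> 8 * h * card {d. d dvd 4 * h}"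
      using h by (intro card_equal_squares_le) auto
    finally have "real (\<Sum>\<beta>\<in>?A. (\<rho> h \<beta>)\<^sup>2) \<le> real (8 * h * card {d. d dvd 4 * h})"
      by (simp only: of_nat_le_iff)
    then have E: "(\<Sum>\<beta>\<in>?A. (real (\<rho> h \<beta>))\<^sup>2) \<le> 8 * real h * real (card {d. d dvd 4 * h})"
      by simp
    have "(dual_weight H h)\<^sup>2 \<le> (1 / (real H * sqrt (real h)))\<^sup>2"
      using h by (intro power_mono dual_weight_le dual_weight_nonneg) auto
    also have "\<dots> = 1 / ((real H)\<^sup>2 * real h)" by (simp add: power_divide power_mult_distrib)
    finally have "(dual_weight H h)\<^sup>2 * (\<Sum>\<beta>\<in>?A. (real (\<rho> h \<beta>))\<^sup>2)
        \<le> 1 / ((real H)\<^sup>2 * real h) * (8 * real h * real (card {d. d dvd 4 * h}))"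
      using E by (intro mult_mono) (auto intro: sum_nonneg)
    also have "\<dots> = 8 / (real H)\<^sup>2 * real (card {d. d dvd 4 * h})"
      using h by simp
    finally show "(dual_weight H h)\<^sup>2 * (\<Sum>\<beta>\<in>?A. (real (\<rho> h \<beta>))\<^sup>2) \<le> 8 / (real H)\<^sup>2 * real (card {d. d dvd 4 * h})" .
  qed simp
  also have "\<dots> = 4 * real H / real R * (8 / (real H)\<^sup>2 * (\<Sum>h\<in>{1..<H}. real (card {d. d dvd 4 * h})))"
    by (simp only: sum_distrib_left)
  also have "\<dots> \<le> 4 * real H / real R * (8 / (real H)\<^sup>2 * (4 * real H * harm (4 * H)))"
    by (intro mult_left_mono sum_card_divisors_le) auto
  also have "\<dots> = 128 * harm (4 * H) / real R"
    using False by (simp add: power2_eq_square)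
  finally show ?thesis .
qed (simp add: dual_index_def harm_nonneg)

text \<open>For nonnegative terms the sum of squares is at most the square of the sum, which is
  affordable at low denominators. The parameter \<open>R\<close> is left free to balance the two
  contributions.\<close>

lemma sum_dual_coeff_squares_le:
  assumes R: "R > 0"
  shows "(\<Sum>\<beta>\<in>dual_freq ` dual_index H. (dual_coeff H \<beta>)\<^sup>2)
     \<le> 16 * (real R) ^ 4 * (harm H)\<^sup>2 / real H + 128 * harm (4 * H) / real R"
proof -
  let ?A = "dual_freq ` dual_index H"
  let ?L = "{\<beta> \<in> ?A. low_denominator R \<beta>}"
  have nonneg: "0 \<le> dual_coeff H \<beta>" for \<beta>
    unfolding dual_coeff_def by (intro sum_nonneg dual_weight_nonneg) (auto simp: dual_index_def)
  have "(\<Sum>\<beta>\<in>?L. (dual_coeff H \<beta>)\<^sup>2) \<le> (\<Sum>\<beta>\<in>?L. dual_coeff H \<beta>)\<^sup>2"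
  proof -
    have "(\<Sum>\<beta>\<in>?L. (dual_coeff H \<beta>)\<^sup>2) \<le> (\<Sum>\<beta>\<in>?L. dual_coeff H \<beta> * (\<Sum>\<beta>\<in>?L. dual_coeff H \<beta>))"
      unfolding power2_eq_square by (intro sum_mono mult_left_mono member_le_sum nonneg) auto
    then show ?thesis by (simp only: sum_distrib_right power2_eq_square)
  qed
  also have "\<dots> \<le> (4 * (real R)\<^sup>2 * harm H / sqrt (real H))\<^sup>2"
    by (intro power_mono sum_dual_coeff_low_denominator_le sum_nonneg nonneg)
  also have "\<dots> = 16 * (real R) ^ 4 * (harm H)\<^sup>2 / real H"
    by (simp add: power_divide power_mult_distrib)
  finally have L: "(\<Sum>\<beta>\<in>?L. (dual_coeff H \<beta>)\<^sup>2) \<le> 16 * (real R) ^ 4 * (harm H)\<^sup>2 / real H" .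
  have "(\<Sum>\<beta>\<in>?A. (dual_coeff H \<beta>)\<^sup>2) = (\<Sum>\<beta>\<in>?L. (dual_coeff H \<beta>)\<^sup>2)
      + (\<Sum>\<beta>\<in>{\<beta> \<in> ?A. \<not> low_denominator R \<beta>}. (dual_coeff H \<beta>)\<^sup>2)"
    by (subst sum.union_disjoint [symmetric]) (auto intro!: sum.cong)
  then show ?thesis
    using L sum_dual_coeff_squares_high_denominator_le[OF R, of H] by linarith
qed

theorem dual_sum_mean_square:
  assumes "H > 0" "R > 0"
  shows "(\<Sum>q\<in>{Q..<Q + M}. (norm (dual_sum H q))\<^sup>2)
     \<le> (real M + 16 * (real H)\<^sup>2 * harm (4 * H\<^sup>2)) * (16 * (real R) ^ 4 * (harm H)\<^sup>2 / real H + 128 * harm (4 * H) / real R)"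
proof -
  have "(\<Sum>q\<in>{Q..<Q + M}. (norm (dual_sum H q))\<^sup>2)
     \<le> (real M + 4 * real (4 * H\<^sup>2) * harm (4 * H\<^sup>2)) * (\<Sum>\<beta>\<in>dual_freq ` dual_index H. (dual_coeff H \<beta>)\<^sup>2)"
    unfolding dual_sum_eq
    by (rule large_sieve) (use assms dual_freq_separated in auto)
  also have "\<dots> \<le> (real M + 4 * real (4 * H\<^sup>2) * harm (4 * H\<^sup>2)) *
      (16 * (real R) ^ 4 * (harm H)\<^sup>2 / real H + 128 * harm (4 * H) / real R)"
    by (intro mult_left_mono sum_dual_coeff_squares_le assms) (simp add: harm_nonneg)
  finally show ?thesis by simp
qed

subsection \<open>The error term of the count\<close>

lemma harm_power2_le: "harm (2 ^ k) \<le> real k + 1"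
proof (induction k)
  case (Suc k)
  have "{1..2 ^ Suc k :: nat} = {1..2 ^ k} \<union> {2 ^ k<..2 ^ Suc k}" by auto
  then have "harm (2 ^ Suc k) = harm (2 ^ k) + (\<Sum>n\<in>{2 ^ k<..2 ^ Suc k}. inverse (real n))"
    unfolding harm_def by (simp only:) (rule sum.union_disjoint, auto)
  also have "(\<Sum>n\<in>{2 ^ k<..2 ^ Suc k}. inverse (real n)) \<le> (\<Sum>n\<in>{2 ^ k<..2 ^ Suc k :: nat}. inverse (2 ^ k))"
  proof (rule sum_mono)
    fix n :: nat assume "n \<in> {2 ^ k<..2 ^ Suc k}"
    then have "real (2 ^ k) \<le> real n" by (subst of_nat_le_iff) simp
    then show "inverse (real n) \<le> inverse (2 ^ k)" by (intro le_imp_inverse_le) auto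
  qed
  also have "\<dots> = 1" by simp
  finally show ?case using Suc by simp
qed (simp add: harm_expand)

text \<open>
  For \<open>q \<approx> 2 ^ i\<close> the lengths \<open>H = 2 ^ j\<close> between about \<open>q powr (1 / 3)\<close> and \<open>q powr 0.51\<close> are left to the
  mean square. Shorter ones are covered by the trivial bound, longer ones by monotonicity in \<open>\<delta>\<close>; any
  exponent slightly above \<open>1 / 2\<close> would do in place of \<open>0.51\<close>.
\<close>

definition top_scale :: "nat \<Rightarrow> nat" where
  "top_scale i = 51 * i div 100"

definition mid_scales :: "nat \<Rightarrow> nat set" where
  "mid_scales i = {j. j \<le> top_scale i \<and> i \<le> 3 * j + 3}"

lemma finite_mid_scales [simp]: "finite (mid_scales i)"
  by (rule finite_subset[of _ "{..top_scale i}"]) (auto simp: mid_scales_def)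

lemma top_scale_in_mid_scales: "top_scale i \<in> mid_scales i"
proof -
  have "i \<le> 3 * (51 * i div 100) + 3"
    using div_mult_mod_eq[of "51 * i" 100] mod_less_divisor[of 100 "51 * i"] by linarith
  then show ?thesis by (simp add: mid_scales_def top_scale_def)
qed

lemma card_mid_scales_le: "card (mid_scales i) \<le> i + 1"
proof -
  have "card (mid_scales i) \<le> card {..i}"
    by (rule card_mono) (auto simp: mid_scales_def top_scale_def)
  then show ?thesis by simp
qed

text \<open>The error must not depend on \<delta>, so it collects all lengths in question: the main
  term at the longest one, and a square sum over scales in place of a maximum, since mean squares
  are what can be averaged over \<open>q\<close>.\<close>

definition count_error :: "nat \<Rightarrow> real" where
  "count_error q = 2 * real q / 2 ^ top_scale (floor_log q)
     + 3 * sqrt (real q) * sqrt (\<Sum>j\<in>mid_scales (floor_log q). (norm (dual_sum (2 ^ j) q))\<^sup>2)"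

lemma count_error_nonneg: "count_error q \<ge> 0"
  unfolding count_error_def by (intro add_nonneg_nonneg mult_nonneg_nonneg) (auto intro: sum_nonneg)

lemma norm_dual_sum_le_mid_scales:
  assumes "j \<in> mid_scales i"
  shows "norm (dual_sum (2 ^ j) q) \<le> sqrt (\<Sum>j\<in>mid_scales i. (norm (dual_sum (2 ^ j) q))\<^sup>2)"
proof (rule real_le_rsqrt)
  show "(norm (dual_sum (2 ^ j) q))\<^sup>2 \<le> (\<Sum>j\<in>mid_scales i. (norm (dual_sum (2 ^ j) q))\<^sup>2)"
    using assms by (intro member_le_sum) auto
qed

text \<open>The condition \<open>H ^ 3 \<le> q\<close> says that
  \<open>sqrt (q * H) \<le> q / H\<close>, so the trivial bound for the dual sum costs at most 6
  such main terms in addition to the 2 already present.\<close>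

lemma quadratic_count_bound_small_scale:
  assumes "q > 0" "H > 0" "H ^ 3 \<le> q"
  shows "real (quadratic_count q (1 / (8 * real H))) \<le> 8 * real q / real H"
proof -
  have "real H ^ 3 \<le> real q" using assms(3) by (metis of_nat_le_iff of_nat_power)
  then have "real q * (real H * (real H)\<^sup>2) \<le> real q * real q"
    by (intro mult_left_mono) (auto simp: power3_eq_cube power2_eq_square mult_ac)
  then have "sqrt (real q) * sqrt (real H) \<le> real q / real H"
    using assms(2) unfolding real_sqrt_mult [symmetric]
    by (intro real_le_lsqrt) (auto simp: power_divide pos_le_divide_eq power2_eq_square mult_ac)
  moreover have "3 * sqrt (real q) * norm (dual_sum H q) \<le> 3 * sqrt (real q) * (2 * sqrt (real H))"
    by (intro mult_left_mono norm_dual_sum_le) auto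
  moreover have "3 * sqrt (real q) * (2 * sqrt (real H)) = 6 * (sqrt (real q) * sqrt (real H))"
    "2 * real q / real H = 2 * (real q / real H)" "8 * real q / real H = 8 * (real q / real H)"
    by simp_all
  ultimately show ?thesis
    using quadratic_count_le_dual_sum[OF assms(1,2)] by linarith
qed

lemma quadratic_count_bound:
  assumes q: "q > 0" and \<delta>: "\<delta> > 0"
  shows "real (quadratic_count q \<delta>) \<le> 128 * \<delta> * real q + count_error q"
proof (cases "\<delta> > 1 / 8")
  case True
  have "real (quadratic_count q \<delta>) \<le> real q" by (simp add: quadratic_count_le)
  also have "\<dots> \<le> 128 * \<delta> * real q" using True q by simp
  finally show ?thesis using count_error_nonneg[of q] by linarith
next
  case False
  define i where "i = floor_log q"
  have i: "2 ^ i \<le> q" unfolding i_def by (rule floor_log_exp2_le) (use q in simp)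
  \<comment> \<open>\<open>1 / (8 * \<delta>)\<close> is rounded down to a power of two. This loses
    at most a factor 2, so \<open>1 / 2 ^ j \<le> 16 * \<delta>\<close>, and the small scales give
    the constant \<open>8 * 16 = 128\<close>.\<close>
  define j where "j = nat \<lfloor>log 2 (1 / (8 * \<delta>))\<rfloor>"
  have "log 2 (1 / (8 * \<delta>)) \<ge> 0" using False \<delta> by (simp add: field_simps)
  then have "real j \<le> log 2 (1 / (8 * \<delta>))" "log 2 (1 / (8 * \<delta>)) < real j + 1"
    unfolding j_def by linarith+
  then have "2 powr real j \<le> 1 / (8 * \<delta>)" "1 / (8 * \<delta>) < 2 powr (real j + 1)"
    using \<delta> by (simp_all add: le_log_iff log_less_iff)
  then have j: "2 ^ j \<le> 1 / (8 * \<delta>)" "1 / (8 * \<delta>) < 2 * 2 ^ j"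
    by (simp_all add: powr_add powr_realpow)
  then have \<delta>j: "\<delta> \<le> 1 / (8 * real (2 ^ j))" "1 / 2 ^ j \<le> 16 * \<delta>"
    using \<delta> by (simp_all add: field_simps)
  have scale: "c * real q / 2 ^ j \<le> 16 * c * \<delta> * real q" if "c \<ge> 0" for c
    using mult_left_mono[OF \<delta>j(2), of "c * real q"] that by (simp add: mult_ac)
  have dual: "3 * sqrt (real q) * norm (dual_sum (2 ^ k) q) \<le> count_error q - 2 * real q / 2 ^ top_scale i"
    if "k \<in> mid_scales i" for k
    using mult_left_mono[OF norm_dual_sum_le_mid_scales[OF that], of "3 * sqrt (real q)" q]
    by (simp add: count_error_def i_def)
  show ?thesis
  proof (cases "j \<le> top_scale i")
    case True
    have N: "real (quadratic_count q \<delta>) \<le> real (quadratic_count q (1 / (8 * real (2 ^ j))))"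
      using quadratic_count_mono[OF \<delta>j(1)] by simp
    show ?thesis
    proof (cases "3 * j \<le> i")
      case True
      have "(2 ^ j) ^ 3 = (2 :: nat) ^ (3 * j)" by (simp add: power_mult mult.commute)
      also have "\<dots> \<le> 2 ^ i" using True by (rule power_increasing) simp
      finally have "(2 ^ j) ^ 3 \<le> q" using i by simp
      from quadratic_count_bound_small_scale[OF q _ this] scale[of 8] N count_error_nonneg[of q]
      show ?thesis by simp
    next
      case False
      then have "j \<in> mid_scales i" using True by (simp add: mid_scales_def)
      from quadratic_count_le_dual_sum[OF q, of "2 ^ j"] dual[OF this] scale[of 2] N
      have "real (quadratic_count q \<delta>) \<le> 32 * \<delta> * real q + count_error q - 2 * real q / 2 ^ top_scale i"
        by simp
      moreover have "0 \<le> 2 * real q / 2 ^ top_scale i" "32 * \<delta> * real q \<le> 128 * \<delta> * real q"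
        using \<delta> by auto
      ultimately show ?thesis by linarith
    qed
  next
    case False
    have "\<delta> \<le> 1 / (8 * real (2 ^ j))" by (rule \<delta>j)
    also have "\<dots> \<le> 1 / (8 * real (2 ^ top_scale i))"
      using False by (intro divide_left_mono) (auto intro: power_increasing)
    finally have "real (quadratic_count q \<delta>) \<le> real (quadratic_count q (1 / (8 * real (2 ^ top_scale i))))"
      using quadratic_count_mono by simp
    with quadratic_count_le_dual_sum[OF q, of "2 ^ top_scale i"] dual[OF top_scale_in_mid_scales]
    have "real (quadratic_count q \<delta>) \<le> count_error q" by simp
    moreover have "0 \<le> 128 * \<delta> * real q" using \<delta> by simp
    ultimately show ?thesis by linarith
  qed
qed

text \<open>The factor \<open>3 * (i + 1)\<close> bounds every harmonic number that occurs. The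
  length is at most \<open>2 powr (51 / 100 * i)\<close>, so the large sieve factor has exponent
  \<open>51 / 50\<close>; the coefficients save \<open>1 / 15\<close>, leaving
  \<open>143 / 150\<close>. The constant is \<open>17 * 544\<close>.\<close>

lemma dual_sum_mean_square_dyadic:
  assumes "j \<in> mid_scales i"
  shows "(\<Sum>q\<in>{2 ^ i..<2 ^ Suc i}. (norm (dual_sum (2 ^ j) q))\<^sup>2)
     \<le> 9248 * (3 * (real i + 1)) ^ 3 * 2 powr (143 / 150 * real i)"
proof -
  define L where "L = 3 * (real i + 1)"
  have L: "L \<ge> 1" by (simp add: L_def)
  have jtop: "100 * j \<le> 51 * i" using assms by (auto simp: mid_scales_def top_scale_def)
  have jlow: "i \<le> 3 * j + 3" using assms by (simp add: mid_scales_def)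
  have ji: "j \<le> i" using jtop by simp
  define R :: nat where "R = 2 ^ (j div 5)" \<comment> \<open>\<open>R \<approx> H powr (1 / 5)\<close> balances \<open>R ^ 4 / H\<close> and \<open>1 / R\<close>\<close>
  have p2: "(2::real) ^ n = 2 powr real n" for n by (simp add: powr_realpow)
  have h1: "harm (4 * (2 ^ j)\<^sup>2) \<le> L"
  proof -
    have "4 * (2 ^ j)\<^sup>2 = (2 :: nat) ^ (2 * j + 2)" by (simp add: power_add power_mult power2_eq_square power_mult_distrib flip: power_mult_distrib)
    then have "harm (4 * (2 ^ j)\<^sup>2) \<le> real (2 * j + 2) + 1" by (simp only: harm_power2_le)
    then show ?thesis using ji by (simp add: L_def)
  qed
  have h2: "harm (2 ^ j) \<le> L"
    using harm_power2_le[of j] ji by (simp add: L_def)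
  have h3: "harm (4 * 2 ^ j) \<le> L"
  proof -
    have "4 * 2 ^ j = (2 :: nat) ^ (j + 2)" by (simp add: power_add)
    then have "harm (4 * 2 ^ j) \<le> real (j + 2) + 1" by (simp only: harm_power2_le)
    then show ?thesis using ji by (simp add: L_def)
  qed
  have A: "real (2 ^ i) + 16 * (real (2 ^ j))\<^sup>2 * harm (4 * (2 ^ j)\<^sup>2) \<le> 17 * L * 2 powr (51 / 50 * real i)"
  proof -
    have "(real (2 ^ j))\<^sup>2 = 2 powr (2 * real j)"
    proof -
      have "(real (2 ^ j))\<^sup>2 = 2 ^ (2 * j)" by (simp add: mult.commute flip: power_mult)
      then show ?thesis by (simp only: p2) simp
    qed
    also have "\<dots> \<le> 2 powr (51 / 50 * real i)" using jtop by (intro powr_mono) auto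
    finally have "(real (2 ^ j))\<^sup>2 * harm (4 * (2 ^ j)\<^sup>2) \<le> 2 powr (51 / 50 * real i) * L"
      using h1 by (intro mult_mono) (auto simp: harm_nonneg)
    moreover have "real (2 ^ i) \<le> 2 powr (51 / 50 * real i) * L"
    proof -
      have "real (2 ^ i) \<le> 2 powr (51 / 50 * real i)" unfolding of_nat_power by (simp add: p2)
      also have "\<dots> \<le> 2 powr (51 / 50 * real i) * L"
        using mult_left_mono[OF L, of "2 powr (51 / 50 * real i)"] by simp
      finally show ?thesis .
    qed
    ultimately show ?thesis by (simp add: algebra_simps)
  qed
  \<comment> \<open>From \<open>i \<le> 3 * j + 3\<close> follows
    \<open>j / 5 \<ge> i / 15 - 1 / 5\<close>; the loss of \<open>1 / 5\<close> is rounded up to a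
    factor 2.\<close>
  have low: "2 powr (- (real j / 5)) \<le> 2 * 2 powr (- (real i / 15))"
  proof -
    have "2 powr (- (real j / 5)) \<le> 2 powr (1 + - (real i / 15))"
      using jlow by (intro powr_mono) auto
    then show ?thesis by (simp only: powr_add) simp
  qed
  have B1: "16 * (real R) ^ 4 * (harm (2 ^ j))\<^sup>2 / real (2 ^ j) \<le> 16 * L\<^sup>2 * 2 powr (- (real j / 5))"
  proof -
    have "(real R) ^ 4 / real (2 ^ j) = 2 powr (4 * real (j div 5) - real j)"
      by (simp add: R_def p2 powr_diff flip: powr_numeral) (simp add: powr_powr mult.commute)
    also have "\<dots> \<le> 2 powr (- (real j / 5))"
    proof (intro powr_mono)
      have "5 * (j div 5) \<le> j" by simp
      then show "4 * real (j div 5) - real j \<le> - (real j / 5)" by linarith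
    qed simp
    finally have "(harm (2 ^ j))\<^sup>2 * ((real R) ^ 4 / real (2 ^ j)) \<le> L\<^sup>2 * 2 powr (- (real j / 5))"
      using h2 by (intro mult_mono power_mono) (auto simp: harm_nonneg)
    then show ?thesis by (simp add: mult_ac)
  qed
  have B2: "128 * harm (4 * 2 ^ j) / real R \<le> 256 * L\<^sup>2 * 2 powr (- (real j / 5))"
  proof -
    have "1 / real R = 2 powr (- real (j div 5))"
      by (simp add: R_def p2 powr_minus divide_inverse)
    also have "\<dots> \<le> 2 powr (1 + - (real j / 5))"
    proof (intro powr_mono)
      have "j \<le> 5 * (j div 5) + 5" by presburger
      then show "- real (j div 5) \<le> 1 + - (real j / 5)" by linarith
    qed simp
    also have "\<dots> = 2 * 2 powr (- (real j / 5))" by (simp only: powr_add) simp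
    finally have "harm (4 * 2 ^ j) * (1 / real R) \<le> L\<^sup>2 * (2 * 2 powr (- (real j / 5)))"
      using h3 L self_le_power[of L 2] by (intro mult_mono) (auto simp: harm_nonneg)
    then show ?thesis by simp
  qed
  have B: "16 * (real R) ^ 4 * (harm (2 ^ j))\<^sup>2 / real (2 ^ j) + 128 * harm (4 * 2 ^ j) / real R
      \<le> 544 * L\<^sup>2 * 2 powr (- (real i / 15))"
  proof -
    have "272 * L\<^sup>2 * 2 powr (- (real j / 5)) \<le> 272 * L\<^sup>2 * (2 * 2 powr (- (real i / 15)))"
      using low by (intro mult_left_mono) auto
    then show ?thesis using B1 B2 by simp
  qed
  have "{2 ^ i..<2 ^ Suc i} = {2 ^ i..<2 ^ i + 2 ^ i :: nat}" by (simp add: mult_2)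
  then have "(\<Sum>q\<in>{2 ^ i..<2 ^ Suc i}. (norm (dual_sum (2 ^ j) q))\<^sup>2)
    \<le> (real (2 ^ i) + 16 * (real (2 ^ j))\<^sup>2 * harm (4 * (2 ^ j)\<^sup>2)) *
       (16 * (real R) ^ 4 * (harm (2 ^ j))\<^sup>2 / real (2 ^ j) + 128 * harm (4 * 2 ^ j) / real R)"
    by (simp only:) (rule dual_sum_mean_square, auto simp: R_def)
  also have "\<dots> \<le> (17 * L * 2 powr (51 / 50 * real i)) * (544 * L\<^sup>2 * 2 powr (- (real i / 15)))"
    using A B L by (intro mult_mono) (auto simp: harm_nonneg)
  also have "\<dots> = 9248 * L ^ 3 * (2 powr (51 / 50 * real i) * 2 powr (- (real i / 15)))"
    by (simp add: power2_eq_square power3_eq_cube)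
  also have "2 powr (51 / 50 * real i) * 2 powr (- (real i / 15)) = 2 powr (143 / 150 * real i)"
    by (simp flip: powr_add)
  finally show ?thesis by (simp only: L_def)
qed

lemma summable_dyadic_blocks:
  fixes f :: "nat \<Rightarrow> real"
  assumes nonneg: "\<And>q. f q \<ge> 0" and B: "summable B"
    and block: "\<And>i. (\<Sum>q\<in>{2 ^ i..<2 ^ Suc i}. f q) \<le> B i"
  shows "summable f"
proof (rule summableI_nonneg_bounded[where x = "f 0 + suminf B"])
  show "0 \<le> f n" for n by (rule nonneg)
  have B_nonneg: "B i \<ge> 0" for i using block[of i] nonneg by (meson order_trans sum_nonneg)
  have dyadic: "(\<Sum>q<2 ^ n. f q) \<le> f 0 + (\<Sum>i<n. B i)" for n
  proof (induction n)
    case 0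
    have "{..<2 ^ 0 :: nat} = {0}" by auto
    then show ?case by simp
  next
    case (Suc n)
    have "{..<2 ^ Suc n :: nat} = {..<2 ^ n} \<union> {2 ^ n..<2 ^ Suc n}" by auto
    then have "(\<Sum>q<2 ^ Suc n. f q) = (\<Sum>q<2 ^ n. f q) + (\<Sum>q\<in>{2 ^ n..<2 ^ Suc n}. f q)"
      by (metis finite_lessThan finite_atLeastLessThan ivl_disj_int_one(2) sum.union_disjoint)
    then show ?case using Suc.IH block[of n] unfolding sum.lessThan_Suc by linarith
  qed
  show "(\<Sum>q<n. f q) \<le> f 0 + suminf B" for n
  proof -
    have "n < 2 ^ n" by (rule less_exp)
    then have "(\<Sum>q<n. f q) \<le> (\<Sum>q<2 ^ n. f q)" by (intro sum_mono2) (auto simp: nonneg)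
    also have "\<dots> \<le> f 0 + (\<Sum>i<n. B i)" by (rule dyadic)
    finally have "(\<Sum>q<n. f q) \<le> f 0 + (\<Sum>i<n. B i)" .
    moreover have "(\<Sum>i<n. B i) \<le> suminf B"
      by (rule sum_le_suminf[OF B]) (simp_all add: B_nonneg)
    ultimately show ?thesis by linarith
  qed
qed

text \<open>A block of \<open>2 ^ i\<close> values contributes
  \<open>2 ^ i / 4 ^ top_scale i\<close> from the main term, which decays because
  \<open>51 / 100\<close> exceeds 1/2, and \<open>1 / 2 ^ i\<close> times the mean squares, which
  decays because \<open>143 / 150\<close> is below 1. The number of scales costs one more factor of
  order \<open>i\<close>.\<close>

lemma summable_count_error: "summable (\<lambda>q. (count_error q / real q)\<^sup>2)"
proof (rule summable_dyadic_blocks)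
  \<comment> \<open>The rounding in \<open>top_scale\<close> costs at most \<open>2 ^ 2\<close>,
    whence \<open>32 = 8 * 4\<close>; the other constant is \<open>18 * 9248\<close>, and
    \<open>7 / 150 = 1 - 143 / 150\<close>.\<close>
  define B where "B = (\<lambda>i::nat. 32 * 2 powr (- (real i / 50)) + 166464 * (3 * (real i + 1)) ^ 4 * 2 powr (- (7 / 150 * real i)))"
  have "B \<in> O(\<lambda>i. 2 powr (- (real i / 100)))"
    unfolding B_def by real_asymp
  moreover have "summable (\<lambda>i. norm (2 powr (- (real i / 100))))"
  proof -
    have "2 powr (- (real i / 100)) = (2 powr (- (1 / 100))) ^ i" for i
      by (simp add: powr_powr flip: powr_realpow)
    moreover have "2 powr (- (1 / 100)) < (1::real)" by (intro powr_less_one) auto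
    ultimately show ?thesis by (simp add: summable_geometric)
  qed
  ultimately show "summable B" by (rule summable_comparison_test_bigo[rotated])
  fix i
  define T where "T = (\<lambda>q. \<Sum>j\<in>mid_scales i. (norm (dual_sum (2 ^ j) q))\<^sup>2)"
  have T: "T q \<ge> 0" for q unfolding T_def by (intro sum_nonneg) auto
  have pos: "(2::nat) ^ i > 0" by simp
  have "(\<Sum>q\<in>{2 ^ i..<2 ^ Suc i}. (count_error q / real q)\<^sup>2) \<le> (\<Sum>q\<in>{2 ^ i..<2 ^ Suc i}. 8 / 4 ^ top_scale i + 18 / 2 ^ i * T q)"
  proof (rule sum_mono)
    fix q :: nat assume q: "q \<in> {2 ^ i..<2 ^ Suc i}"
    then have q0: "q > 0" using pos by (auto intro: order.strict_trans2)
    have fl: "floor_log q = i" using q by (intro floor_log_eqI) auto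
    let ?x = "2 / 2 ^ top_scale i :: real" and ?y = "3 * sqrt (T q) / sqrt (real q)"
    have "count_error q / real q = ?x + ?y"
    proof -
      have "sqrt (real q) / real q = 1 / sqrt (real q)" using q0 by (simp add: field_simps)
      then have "3 * sqrt (T q) * (sqrt (real q) / real q) = ?y" by simp
      then show ?thesis using q0 by (simp add: count_error_def fl T_def add_divide_distrib mult_ac)
    qed
    then have "(count_error q / real q)\<^sup>2 = (?x + ?y)\<^sup>2" by simp
    also have "\<dots> \<le> 2 * ?x\<^sup>2 + 2 * ?y\<^sup>2"
      using sum_squares_bound[of ?x ?y] by (simp add: power2_sum)
    also have "?x\<^sup>2 = 4 / 4 ^ top_scale i"
      by (simp add: power_divide power2_eq_square flip: power_mult_distrib)
    also have "?y\<^sup>2 = 9 * T q / real q"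
      using T[of q] by (simp add: power_divide power_mult_distrib)
    also have "9 * T q / real q \<le> 9 * T q / 2 ^ i"
    proof -
      have "real (2 ^ i) \<le> real q" using q by (subst of_nat_le_iff) simp
      then show ?thesis using T[of q] q0 by (intro divide_left_mono) auto
    qed
    finally show "(count_error q / real q)\<^sup>2 \<le> 8 / 4 ^ top_scale i + 18 / 2 ^ i * T q" by simp
  qed
  also have "\<dots> = 2 ^ i * (8 / 4 ^ top_scale i) + 18 / 2 ^ i * (\<Sum>q\<in>{2 ^ i..<2 ^ Suc i}. T q)"
    by (simp add: sum.distrib sum_distrib_left)
  also have "(\<Sum>q\<in>{2 ^ i..<2 ^ Suc i}. T q) = (\<Sum>j\<in>mid_scales i. \<Sum>q\<in>{2 ^ i..<2 ^ Suc i}. (norm (dual_sum (2 ^ j) q))\<^sup>2)"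
    unfolding T_def by (rule sum.swap)
  also have "\<dots> \<le> (\<Sum>j\<in>mid_scales i. 9248 * (3 * (real i + 1)) ^ 3 * 2 powr (143 / 150 * real i))"
    by (intro sum_mono dual_sum_mean_square_dyadic)
  also have "\<dots> = real (card (mid_scales i)) * (9248 * (3 * (real i + 1)) ^ 3 * 2 powr (143 / 150 * real i))"
    by simp
  also have "\<dots> \<le> (3 * (real i + 1)) * (9248 * (3 * (real i + 1)) ^ 3 * 2 powr (143 / 150 * real i))"
    using card_mid_scales_le[of i] by (intro mult_right_mono) auto
  also have "\<dots> = 9248 * (3 * (real i + 1)) ^ 4 * 2 powr (143 / 150 * real i)"
    by (simp add: power4_eq_xxxx power3_eq_cube)
  also have "2 ^ i * (8 / 4 ^ top_scale i) \<le> 32 * 2 powr (- (real i / 50))"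
  proof -
    have "51 * i \<le> 100 * top_scale i + 99"
      unfolding top_scale_def
      using div_mult_mod_eq[of "51 * i" 100] mod_less_divisor[of 100 "51 * i"] by linarith
    then have t: "real i - 2 * real (top_scale i) \<le> 2 + - (real i / 50)" by linarith
    have "(2::real) ^ i / 4 ^ top_scale i = 2 powr (real i - 2 * real (top_scale i))"
    proof -
      have "(4::real) ^ top_scale i = 2 ^ (2 * top_scale i)" by (simp add: power_mult)
      moreover have "(2::real) ^ n = 2 powr real n" for n by (simp add: powr_realpow)
      ultimately have "(2::real) ^ i / 4 ^ top_scale i = 2 powr real i / 2 powr real (2 * top_scale i)"
        by metis
      also have "\<dots> = 2 powr (real i - real (2 * top_scale i))" by (rule powr_diff [symmetric])
      finally show ?thesis by simp
    qed
    also have "\<dots> \<le> 2 powr (2 + - (real i / 50))" using t by (intro powr_mono) auto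
    also have "\<dots> = 4 * 2 powr (- (real i / 50))" by (simp only: powr_add) simp
    finally have "(2::real) ^ i / 4 ^ top_scale i \<le> 4 * 2 powr (- (real i / 50))" .
    moreover have "2 ^ i * (8 / 4 ^ top_scale i) = 8 * ((2::real) ^ i / 4 ^ top_scale i)" by simp
    ultimately show ?thesis by linarith
  qed
  finally have "(\<Sum>q\<in>{2 ^ i..<2 ^ Suc i}. (count_error q / real q)\<^sup>2)
     \<le> 32 * 2 powr (- (real i / 50)) + 18 / 2 ^ i * (9248 * (3 * (real i + 1)) ^ 4 * 2 powr (143 / 150 * real i))"
    by (simp add: mult_left_mono divide_right_mono)
  also have "18 / 2 ^ i * (9248 * (3 * (real i + 1)) ^ 4 * 2 powr (143 / 150 * real i))
      = 166464 * (3 * (real i + 1)) ^ 4 * (2 powr (143 / 150 * real i) / 2 powr real i)"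
    by (simp add: powr_realpow)
  also have "2 powr (143 / 150 * real i) / 2 powr real i = 2 powr (- (7 / 150 * real i))"
    by (simp flip: powr_diff)
  finally show "(\<Sum>q\<in>{2 ^ i..<2 ^ Suc i}. (count_error q / real q)\<^sup>2) \<le> B i"
    by (simp only: B_def)
qed simp

subsection \<open>Approximable points on the parabola\<close>

definition approx_set :: "nat \<Rightarrow> real \<Rightarrow> real set" where
  "approx_set q \<epsilon> = {x \<in> {0..1}. infdist (real q * x) \<int> < \<epsilon> \<and> infdist (real q * x\<^sup>2) \<int> < \<epsilon>}"

lemma approx_set_sets [measurable]: "approx_set q \<epsilon> \<in> sets lborel"
proof -
  have "approx_set q \<epsilon> = {0..1} \<inter> {x. infdist (real q * x) \<int> < \<epsilon>} \<inter> {x. infdist (real q * x\<^sup>2) \<int> < \<epsilon>}"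
    by (auto simp: approx_set_def)
  moreover have "open {x. infdist (real q * x) \<int> < \<epsilon>}" "open {x. infdist (real q * x\<^sup>2) \<int> < \<epsilon>}"
    by (intro open_Collect_less continuous_intros)+
  ultimately show ?thesis by auto
qed

lemma infdist_Ints_less_iff: "infdist (x::real) \<int> < \<epsilon> \<longleftrightarrow> (\<exists>m::int. \<bar>x - of_int m\<bar> < \<epsilon>)"
proof
  assume "infdist x \<int> < \<epsilon>"
  moreover obtain y :: real where "y \<in> \<int>" "infdist x \<int> = dist x y"
    using infdist_attains_inf[of "\<int> :: real set" x] closed_Ints Ints_0 by (metis empty_iff)
  ultimately show "\<exists>m::int. \<bar>x - of_int m\<bar> < \<epsilon>" by (auto simp: dist_real_def elim!: Ints_cases)
next
  assume "\<exists>m::int. \<bar>x - of_int m\<bar> < \<epsilon>"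
  then obtain m :: int where "\<bar>x - of_int m\<bar> < \<epsilon>" by blast
  moreover have "infdist x \<int> \<le> dist x (of_int m)" by (rule infdist_le) simp
  ultimately show "infdist x \<int> < \<epsilon>" by (simp add: dist_real_def)
qed

text \<open>With \<open>p = q * x + \<theta>\<close> one has
  \<open>p^2 / q - q * x^2 = 2 * x * \<theta> + \<theta>^2 / q\<close>, of size at most
  \<open>3 * \<epsilon>\<close>; the distance of \<open>q * x^2\<close> to its integer adds the
  fourth \<epsilon>.\<close>

lemma approx_set_subset:
  assumes q: "q > 0" and \<epsilon>: "\<epsilon> \<le> 1 / 2"
  shows "approx_set q \<epsilon> \<subseteq> (\<Union>p\<in>{p. p \<le> q \<and> (\<exists>m::int. \<bar>(real p)\<^sup>2 / real q - of_int m\<bar> < 4 * \<epsilon>)}.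
           {(real p - \<epsilon>) / real q..(real p + \<epsilon>) / real q})"
proof
  fix x assume "x \<in> approx_set q \<epsilon>"
  then obtain p' m :: int where x: "0 \<le> x" "x \<le> 1" and p': "\<bar>real q * x - of_int p'\<bar> < \<epsilon>"
    and m: "\<bar>real q * x\<^sup>2 - of_int m\<bar> < \<epsilon>"
    unfolding approx_set_def infdist_Ints_less_iff by auto
  have qx: "0 \<le> real q * x" "real q * x \<le> real q" using x q by auto
  have "-1 < real_of_int p'" "real_of_int p' < real q + 1" using p' \<epsilon> qx by linarith+
  then have "0 \<le> p'" "p' \<le> int q" by linarith+
  then obtain p where p: "p' = int p" "p \<le> q" by (metis nonneg_int_cases of_nat_le_iff)
  define \<theta> where "\<theta> = real p - real q * x"
  have \<theta>: "\<bar>\<theta>\<bar> < \<epsilon>" using p' by (simp add: \<theta>_def p abs_minus_commute)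
  have "(real p)\<^sup>2 / real q - real q * x\<^sup>2 = 2 * x * \<theta> + \<theta>\<^sup>2 / real q"
    using q by (simp add: \<theta>_def power2_eq_square field_simps)
  moreover have "\<bar>2 * x * \<theta>\<bar> \<le> 2 * \<epsilon>"
  proof -
    have "\<bar>x * \<theta>\<bar> \<le> 1 * \<epsilon>" unfolding abs_mult using x \<theta> by (intro mult_mono) auto
    then show ?thesis by (simp add: abs_mult)
  qed
  moreover have "\<bar>\<theta>\<^sup>2 / real q\<bar> \<le> \<epsilon>"
  proof -
    have "\<theta>\<^sup>2 / real q \<le> \<theta>\<^sup>2 / 1" using q by (intro divide_left_mono) auto
    also have "\<theta>\<^sup>2 = \<bar>\<theta>\<bar> * \<bar>\<theta>\<bar>" by (simp add: power2_eq_square)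
    also have "\<bar>\<theta>\<bar> * \<bar>\<theta>\<bar> / 1 \<le> 1 * \<epsilon>" using \<theta> \<epsilon> unfolding div_by_1 by (intro mult_mono) auto
    finally show ?thesis by (simp add: power2_eq_square)
  qed
  ultimately have "\<bar>(real p)\<^sup>2 / real q - of_int m\<bar> < 4 * \<epsilon>" using m by linarith
  moreover have "x \<in> {(real p - \<epsilon>) / real q..(real p + \<epsilon>) / real q}"
    using \<theta> q by (auto simp: \<theta>_def field_simps)
  ultimately show "x \<in> (\<Union>p\<in>{p. p \<le> q \<and> (\<exists>m::int. \<bar>(real p)\<^sup>2 / real q - of_int m\<bar> < 4 * \<epsilon>)}.
           {(real p - \<epsilon>) / real q..(real p + \<epsilon>) / real q})"
    using p(2) by blast
qed

text \<open>The covering intervals have length \<open>2 * \<epsilon> / q\<close>. The cross term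
  between \<epsilon> and the counting error is split by the arithmetic-geometric mean, which
  decouples \<psi> from the error and explains \<open>2050 = 2048 + 2\<close>.\<close>

lemma measure_approx_set_le:
  assumes q: "q > 0" and \<epsilon>: "0 \<le> \<epsilon>" "\<epsilon> \<le> 1 / 2"
  shows "measure lborel (approx_set q \<epsilon>) \<le> 2050 * \<epsilon>\<^sup>2 + 2 * (count_error q / real q)\<^sup>2"
proof (cases "\<epsilon> = 0")
  case True
  then have "approx_set q \<epsilon> = {}" using infdist_nonneg by (auto simp: approx_set_def not_less)
  then show ?thesis by simp
next
  case False
  then have pos: "\<epsilon> > 0" using \<epsilon> by simp
  define P where "P = {p. p \<le> q \<and> (\<exists>m::int. \<bar>(real p)\<^sup>2 / real q - of_int m\<bar> < 4 * \<epsilon>)}"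
  define P' where "P' = {p. p < q \<and> (\<exists>m::int. \<bar>(real p)\<^sup>2 / real q - of_int m\<bar> < 4 * \<epsilon>)}"
  have fin: "finite P" "finite P'" by (simp_all add: P_def P'_def)
  have "card P \<le> card (insert q P')" using fin by (intro card_mono) (auto simp: P_def P'_def)
  also have "\<dots> \<le> card P' + 1" using card_insert_le_m1 by (simp add: card_insert_if fin)
  \<comment> \<open>The covering also needs \<open>p = q\<close>, which the count over
    \<open>p < q\<close> omits. As \<open>p = 0\<close> is always counted, this extra point at most
    doubles the count.\<close>
  also have "1 \<le> card P'"
  proof -
    have "0 \<in> P'" using q pos unfolding P'_def by (auto intro!: exI[of _ 0])
    then show ?thesis using fin by (metis One_nat_def Suc_leI card_gt_0_iff empty_iff)
  qed
  finally have "card P \<le> 2 * quadratic_count q (4 * \<epsilon>)"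
    by (simp add: quadratic_count_def P'_def)
  then have N: "real (card P) \<le> 2 * real (quadratic_count q (4 * \<epsilon>))"
    by (metis of_nat_le_iff of_nat_mult of_nat_numeral)
  have sub: "approx_set q \<epsilon> \<subseteq> (\<Union>p\<in>P. {(real p - \<epsilon>) / real q..(real p + \<epsilon>) / real q})"
    using approx_set_subset[OF q \<epsilon>(2)] by (simp add: P_def)
  have "measure lborel (approx_set q \<epsilon>) \<le> measure lborel (\<Union>p\<in>P. {(real p - \<epsilon>) / real q..(real p + \<epsilon>) / real q})"
  proof (rule measure_mono_fmeasurable[OF sub approx_set_sets])
    show "(\<Union>p\<in>P. {(real p - \<epsilon>) / real q..(real p + \<epsilon>) / real q}) \<in> fmeasurable lborel"
      using fin by (intro fmeasurableI emeasure_bounded_finite bounded_UN) auto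
  qed
  also have "\<dots> \<le> (\<Sum>p\<in>P. measure lborel {(real p - \<epsilon>) / real q..(real p + \<epsilon>) / real q})"
    using fin by (intro measure_UNION_le) auto
  also have "\<dots> = (\<Sum>p\<in>P. 2 * \<epsilon> / real q)"
  proof (rule sum.cong)
    fix p assume "p \<in> P"
    have "(real p - \<epsilon>) / real q \<le> (real p + \<epsilon>) / real q" using pos by (intro divide_right_mono) auto
    then show "measure lborel {(real p - \<epsilon>) / real q..(real p + \<epsilon>) / real q} = 2 * \<epsilon> / real q"
      by (simp add: diff_divide_distrib [symmetric])
  qed simp
  also have "\<dots> = real (card P) * (2 * \<epsilon> / real q)" by simp
  also have "\<dots> \<le> (2 * (128 * (4 * \<epsilon>) * real q + count_error q)) * (2 * \<epsilon> / real q)"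
    using N quadratic_count_bound[OF q, of "4 * \<epsilon>"] pos by (intro mult_right_mono) auto
  also have "\<dots> = 2048 * \<epsilon>\<^sup>2 + 2 * (2 * \<epsilon> * (count_error q / real q))"
    using q by (simp add: field_simps power2_eq_square)
  also have "2 * \<epsilon> * (count_error q / real q) \<le> \<epsilon>\<^sup>2 + (count_error q / real q)\<^sup>2"
    by (rule sum_squares_bound)
  finally show ?thesis by simp
qed

text \<open>First Borel-Cantelli lemma: both \<open>\<psi> (q)^2\<close> and the squared relative
  error are summable. The index is shifted by one because denominators start at 1.\<close>

lemma AE_finite_approx_set:
  assumes \<psi>: "\<And>q. q \<ge> 1 \<Longrightarrow> 0 \<le> \<psi> q" and sum: "summable (\<lambda>q. \<psi> (Suc q) ^ 2)"
  shows "AE x in lborel. finite {q. q \<ge> 1 \<and> x \<in> approx_set q (\<psi> q)}"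
proof -
  let ?A = "\<lambda>q. approx_set (Suc q) (\<psi> (Suc q))"
  have A_le: "emeasure lborel (?A q) \<le> 1" for q
  proof -
    have "emeasure lborel (?A q) \<le> emeasure lborel {0..1::real}"
      by (rule emeasure_mono) (auto simp: approx_set_def)
    then show ?thesis by simp
  qed
  have "AE x in lborel. eventually (\<lambda>q. x \<in> space lborel - ?A q) sequentially"
  proof (rule borel_cantelli_AE1)
    show "emeasure lborel (?A q) < \<infinity>" for q using A_le[of q] by (metis ennreal_one_less_top infinity_ennreal_def order_le_less_trans)
    have "(\<lambda>q. \<psi> (Suc q) ^ 2) \<longlonglongrightarrow> 0" by (rule summable_LIMSEQ_zero[OF sum])
    \<comment> \<open>The measure bound assumes \<open>\<epsilon> \<le> 1 / 2\<close>, which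
      summability guarantees for all but finitely many \<open>q\<close>; an eventual bound suffices
      for comparison.\<close>
    then have "\<forall>\<^sub>F q in sequentially. \<psi> (Suc q) ^ 2 < (1 / 2)\<^sup>2" by (rule order_tendstoD) simp
    then have "\<forall>\<^sub>F q in sequentially. norm (measure lborel (?A q))
        \<le> 2050 * \<psi> (Suc q) ^ 2 + 2 * (count_error (Suc q) / real (Suc q))\<^sup>2"
    proof eventually_elim
      case (elim q)
      then have "\<psi> (Suc q) < 1 / 2" by (rule power_less_imp_less_base) simp
      then show ?case using measure_approx_set_le[of "Suc q" "\<psi> (Suc q)"] \<psi>[of "Suc q"] by simp
    qed
    moreover have "summable (\<lambda>q. 2050 * \<psi> (Suc q) ^ 2 + 2 * (count_error (Suc q) / real (Suc q))\<^sup>2)"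
      using summable_count_error by (intro summable_add summable_mult sum) (subst summable_Suc_iff)
    ultimately show "summable (\<lambda>q. measure lborel (?A q))"
      by (rule summable_comparison_test_ev)
  qed (rule approx_set_sets)
  then show ?thesis
  proof eventually_elim
    case (elim x)
    then obtain N where N: "\<And>q. q \<ge> N \<Longrightarrow> x \<notin> ?A q" by (auto simp: eventually_sequentially)
    have "{q. q \<ge> 1 \<and> x \<in> approx_set q (\<psi> q)} \<subseteq> {..N}"
    proof
      fix q assume "q \<in> {q. q \<ge> 1 \<and> x \<in> approx_set q (\<psi> q)}"
      then have "1 \<le> q" "x \<in> approx_set q (\<psi> q)" by auto
      then have "\<not> N \<le> q - 1" using N[of "q - 1"] by auto
      then show "q \<in> {..N}" by auto
    qed
    then show ?case by (rule finite_subset) simp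
  qed
qed

section \<open>Measurability and transfer to the curve\<close>

lemma Max_infdist_less_iff:
  fixes x :: "real^2"
  shows "(MAX i. infdist (a * x $ i) \<int>) < \<epsilon> \<longleftrightarrow> infdist (a * x $ 1) \<int> < \<epsilon> \<and> infdist (a * x $ 2) \<int> < \<epsilon>"
  by (subst Max_less_iff) (auto simp: image_iff forall_2)

text \<open>A limit superior of open sets. Measurability has to be shown because it is part of being
  a null set.\<close>

lemma approximable_borel: "(approximable \<psi> :: (real^2) set) \<in> sets borel"
proof -
  define B where "B = (\<lambda>q. {x :: real^2. infdist (real q * x $ 1) \<int> < \<psi> q \<and> infdist (real q * x $ 2) \<int> < \<psi> q})"
  have B: "B q \<in> sets borel" for q
    unfolding B_def by (intro borel_open open_Collect_conj open_Collect_less continuous_intros)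
  have "approximable \<psi> = (\<Inter>n. \<Union>q\<in>{q. q \<ge> n \<and> q \<ge> 1}. B q)"
  proof (intro set_eqI iffI)
    fix x :: "real^2" assume "x \<in> approximable \<psi>"
    then have "infinite {q. q \<ge> 1 \<and> x \<in> B q}"
      by (simp add: approximable_def Max_infdist_less_iff B_def)
    then show "x \<in> (\<Inter>n. \<Union>q\<in>{q. q \<ge> n \<and> q \<ge> 1}. B q)"
      unfolding infinite_nat_iff_unbounded_le by blast
  next
    fix x :: "real^2" assume "x \<in> (\<Inter>n. \<Union>q\<in>{q. q \<ge> n \<and> q \<ge> 1}. B q)"
    then have "infinite {q. q \<ge> 1 \<and> x \<in> B q}"
      unfolding infinite_nat_iff_unbounded_le by blast
    then show "x \<in> approximable \<psi>"
      by (simp add: approximable_def Max_infdist_less_iff B_def)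
  qed
  also have "\<dots> \<in> sets borel"
    by (intro sets.countable_INT' sets.countable_UN') (auto simp: B)
  finally show ?thesis .
qed

lemma parabola_borel: "parabola \<in> sets borel"
proof -
  have "continuous_on {0..1} parabola_curve"
    using parabola_curve_has_vector_derivative by (rule continuous_on_vector_derivative)
  then have "compact parabola" unfolding parabola_def by (intro compact_continuous_image) auto
  then show ?thesis by (intro borel_closed compact_imp_closed)
qed

theorem theorem1:
  "strong_Khintchine_convergence parabola (arc_length_measure parabola_curve 0 1)"
  unfolding strong_Khintchine_convergence_def
proof (intro allI impI)
  fix \<psi> :: "nat \<Rightarrow> real"
  assume \<psi>: "\<forall>q\<ge>1. 0 \<le> \<psi> q" and "summable (\<lambda>q. \<psi> (Suc q) ^ CARD(2))"
  then have sum: "summable (\<lambda>q. \<psi> (Suc q) ^ 2)" by simp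
  have ae: "AE x in lborel. finite {q. q \<ge> 1 \<and> x \<in> approx_set q (\<psi> q)}"
    by (rule AE_finite_approx_set) (use \<psi> sum in auto)
  let ?S = "approximable \<psi> \<inter> parabola"
  have S: "?S \<in> sets borel" by (intro sets.Int approximable_borel parabola_borel)
  \<comment> \<open>At a point of the parabola the two coordinate conditions are those of
    \<open>approx_set\<close>, so approximability of the point means that \<open>t\<close> lies in
    infinitely many of these sets. The density of arc length thus multiplies an indicator that
    vanishes almost everywhere on \<open>[0, 1]\<close>.\<close>
  have zero: "AE t in lborel. ennreal (sqrt (1 + 4 * t\<^sup>2)) * indicator ?S (vector [t, t\<^sup>2] :: real^2) * indicator {0..1} t = 0"
    using ae
  proof eventually_elim
    case (elim t)
    have "(vector [t, t\<^sup>2] :: real^2) \<notin> approximable \<psi>" if "t \<in> {0..1}"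
      using elim that
      unfolding approximable_def mem_Collect_eq approx_set_def by (simp add: forall_2)
    then show ?case by (auto split: split_indicator)
  qed
  have "emeasure (arc_length_measure parabola_curve 0 1) ?S = 0"
    unfolding emeasure_arc_length_measure_parabola[OF S]
    using zero by (subst nn_integral_cong_AE[OF zero]) simp
  then show "?S \<in> null_sets (arc_length_measure parabola_curve 0 1)"
    using S by (simp add: null_sets_def arc_length_measure_def)
qed

end
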